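(* Consider the integral-difference equation $$x(t)=\sum_{i=1}^k\sum_{j=1}^{\ell}H_{ij}\,x\bigl(t-(r_i+s_j)\bigr)+\int_{-\tau}^0 w_1(\theta)x(t+\theta)\,d\theta+u(t).$$ Its zero solution with $u=0$ is strongly stable if and only if $c_0(\vec r,\vec s)<0$ and $\gamma_0<1$, where $$\gamma_0\triangleq\max_{\vec\theta\in[0,2\pi]^k,\ \vec\nu\in[0,2\pi]^{\ell}}\rho\left(\sum_{i=1}^k\sum_{j=1}^{\ell}H_{ij}e^{\imath(\theta_i+\nu_j)}\right).$$
   Context: Here $k,\ell\geq 1$ are integers, $x(t),u(t)\in\mathbb{R}^{\ell}$, $H_{ij}\in\mathbb{R}^{\ell\times\ell}$, $w_1:[-\tau,0]\to\mathbb{R}^{\ell\times\ell}$ is piecewise continuously differentiable, and the delays satisfy $r_1>\cdots>r_k>0$, $s_1>\cdots>s_\ell>0$, $\tau=r_1+s_1$. Write $\vec r=(r_1,\ldots,r_k)$, $\vec s=(s_1,\ldots,s_\ell)$. $\imath$ is the imaginary unit and $\rho(\cdot)$ is the spectral radius of a matrix. The spectral abscissa of the equation with $u=0$, as a function of the discrete delays (the kernel $w_1$ and the number $\tau$ being kept fixed), is $$c_0(\vec r,\vec s)\triangleq\sup_{\lambda\in\mathbb{C}}\left\{\Re(\lambda):\ \det\left(-I+\sum_{i=1}^k\sum_{j=1}^{\ell}H_{ij}e^{-\lambda(r_i+s_j)}+\int_{-\tau}^0w_1(\theta)e^{\lambda\theta}d\theta\right)=0\right\}.$$ Strong stability: the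 zero solution of the equation with $u=0$ is called strongly stable if there exist numbers $\epsilon_1>0$ and $\epsilon_2>0$ such that $c_0(\vec r+\Delta\vec r,\vec s+\Delta\vec s)<-\epsilon_2$ for all $\Delta\vec r\in\mathbb{R}^k$ and $\Delta\vec s\in\mathbb{R}^{\ell}$ satisfying $\|\Delta\vec r\|_2<\epsilon_1$, $\|\Delta\vec s\|_2<\epsilon_1$, $r_i+\Delta r_i\geq0$ for $1\leq i\leq k$, and $s_j+\Delta s_j\geq0$ for $1\leq j\leq\ell$. *)

theory Defs
  imports
    "HOL-Analysis.Analysis"
    "HOL-Library.Extended_Real"
    "Jordan_Normal_Form.Spectral_Radius"
begin

hide_const (open) Determinants.det Finite_Cartesian_Product.mat

text \<open>
  Piecewise continuously differentiable on \<open>[a, b]\<close>: on each open piece of some partition,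
  \<open>f\<close> agrees with a function that is continuously differentiable on the closed piece.
  Thus \<open>f\<close> may jump at the partition points and its values there are arbitrary; the library
  notion \<open>piecewise_C1_differentiable_on\<close> instead demands global continuity, but does
  not demand that the derivative has one-sided limits at the exceptional points.
\<close>

definition piecewise_C1_on :: "(real \<Rightarrow> real) \<Rightarrow> real \<Rightarrow> real \<Rightarrow> bool" where
  "piecewise_C1_on f a b \<longleftrightarrow>
     (\<exists>(m::nat) (p :: nat \<Rightarrow> real). p 0 = a \<and> p m = b \<and>
        (\<forall>i<m. p i < p (Suc i) \<and>
           (\<exists>g. g C1_differentiable_on {p i..p (Suc i)} \<and>
                (\<forall>t\<in>{p i<..<p (Suc i)}. f t = g t))))"

text \<open>
  All index families are functions on \<open>nat\<close> of which only the values at the indices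
  \<open>1..k\<close> and \<open>1..l\<close> matter. The following is the matrix sum over \<open>i, j\<close> of
  \<open>c i j \<cdot> H i j\<close>, written out entrywise because matrices with a carrier dimension form no
  additive monoid type.
\<close>

definition weighted_sum ::
    "nat \<Rightarrow> nat \<Rightarrow> (nat \<Rightarrow> nat \<Rightarrow> real mat) \<Rightarrow> (nat \<Rightarrow> nat \<Rightarrow> complex) \<Rightarrow> complex mat" where
  "weighted_sum k l H c =
     mat l l (\<lambda>(a, b). \<Sum>i=1..k. \<Sum>j=1..l. complex_of_real (H i j $$ (a, b)) * c i j)"

definition kernel_transform :: "nat \<Rightarrow> (real \<Rightarrow> real mat) \<Rightarrow> real \<Rightarrow> complex \<Rightarrow> complex mat" where
  "kernel_transform l w1 \<tau> z =
     mat l l (\<lambda>(a, b). integral {-\<tau>..0}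
       (\<lambda>t. complex_of_real (w1 t $$ (a, b)) * exp (z * complex_of_real t)))"

definition char_matrix_IDE ::
    "nat \<Rightarrow> nat \<Rightarrow> (nat \<Rightarrow> nat \<Rightarrow> real mat) \<Rightarrow> (real \<Rightarrow> real mat) \<Rightarrow> real
      \<Rightarrow> (nat \<Rightarrow> real) \<Rightarrow> (nat \<Rightarrow> real) \<Rightarrow> complex \<Rightarrow> complex mat" where
  "char_matrix_IDE k l H w1 \<tau> r s z =
     - 1\<^sub>m l
     + weighted_sum k l H (\<lambda>i j. exp (- z * complex_of_real (r i + s j)))
     + kernel_transform l w1 \<tau> z"

text \<open>
  The spectral abscissa is extended-real-valued: it is \<open>-\<infinity>\<close> if there is no
  characteristic root, and can be \<open>\<infinity>\<close> only if some delay \<open>r i + s j\<close> is not positive. Note that \<open>\<tau>\<close> is a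
  parameter independent of the delays.
\<close>

definition c0 ::
    "nat \<Rightarrow> nat \<Rightarrow> (nat \<Rightarrow> nat \<Rightarrow> real mat) \<Rightarrow> (real \<Rightarrow> real mat) \<Rightarrow> real
      \<Rightarrow> (nat \<Rightarrow> real) \<Rightarrow> (nat \<Rightarrow> real) \<Rightarrow> ereal" where
  "c0 k l H w1 \<tau> r s =
     Sup {ereal (Re z) | z :: complex. det (char_matrix_IDE k l H w1 \<tau> r s z) = 0}"

definition strongly_stable ::
    "nat \<Rightarrow> nat \<Rightarrow> (nat \<Rightarrow> nat \<Rightarrow> real mat) \<Rightarrow> (real \<Rightarrow> real mat) \<Rightarrow> real
      \<Rightarrow> (nat \<Rightarrow> real) \<Rightarrow> (nat \<Rightarrow> real) \<Rightarrow> bool" where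
  "strongly_stable k l H w1 \<tau> r s \<longleftrightarrow>
     (\<exists>\<epsilon>1 \<epsilon>2 :: real. \<epsilon>1 > 0 \<and> \<epsilon>2 > 0 \<and>
        (\<forall>dr ds :: nat \<Rightarrow> real.
           L2_set dr {1..k} < \<epsilon>1 \<and> L2_set ds {1..l} < \<epsilon>1 \<and>
           (\<forall>i\<in>{1..k}. r i + dr i \<ge> 0) \<and> (\<forall>j\<in>{1..l}. s j + ds j \<ge> 0) \<longrightarrow>
           c0 k l H w1 \<tau> (\<lambda>i. r i + dr i) (\<lambda>j. s j + ds j) < ereal (- \<epsilon>2)))"

text \<open>
  The supremum is a maximum, because the spectral radius is continuous and the
  parameters range over a compact set.
\<close>

definition gamma0 :: "nat \<Rightarrow> nat \<Rightarrow> (nat \<Rightarrow> nat \<Rightarrow> real mat) \<Rightarrow> real" where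
  "gamma0 k l H =
     Sup {spectral_radius (weighted_sum k l H (\<lambda>i j. exp (\<i> * complex_of_real (\<theta> i + \<nu> j))))
          | \<theta> \<nu>. (\<forall>i\<in>{1..k}. \<theta> i \<in> {0..2 * pi}) \<and> (\<forall>j\<in>{1..l}. \<nu> j \<in> {0..2 * pi})}"

end

theory Submission
  imports Defs "HOL-Complex_Analysis.Complex_Analysis"
begin

hide_const (open) Determinants.det Finite_Cartesian_Product.mat

text \<open>
  Replace the exponentials \<open>exp (- z r\<^sub>i)\<close>, \<open>exp (- z s\<^sub>j)\<close> in the characteristic determinant by independent
  variables \<open>a\<^sub>i\<close>, \<open>b\<^sub>j\<close>, and the kernel transform, which is \<open>O(1 / z)\<close> on right half planes, by zero. The
  condition \<open>\<gamma>\<^sub>0 < 1\<close> says that the resulting polynomial has no zero on the tori of radius at most \<open>1\<close>;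
  by the maximum principle it has none on the closed unit polydisc, and by compactness none on a slightly
  larger one, even after a small perturbation of the matrix. This excludes roots of large modulus uniformly
  in the delays, and \<open>c\<^sub>0 < 0\<close> controls the remaining compact set of \<open>z\<close> by continuity.

  Conversely, if \<open>\<gamma>\<^sub>0 \<ge> 1\<close>, the polynomial vanishes at some \<open>a\<^sub>i = x\<^sub>i \<sigma>\<^bsup>r\<^sub>i\<^esup>\<close>, \<open>b\<^sub>j = y\<^sub>j \<sigma>\<^bsup>s\<^sub>j\<^esup>\<close> with unimodular
  \<open>x\<^sub>i\<close>, \<open>y\<^sub>j\<close> and \<open>0 < \<sigma> \<le> 1\<close>. Arbitrarily small changes of the delays realise the phases at a high frequency, and Hurwitz's
  theorem gives a root close to or inside the right half plane.
\<close>

section \<open>Zero-free polydiscs\<close>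

text \<open>Tychonoff's theorem, restated for the function type: polydiscs and tori stay compact
  even with infinitely many coordinates.\<close>

lemma compact_functions_into:
  fixes S :: "'b::topological_space set"
  assumes "compact S"
  shows "compact {f :: 'a \<Rightarrow> 'b. \<forall>i. f i \<in> S}"
proof -
  have "compactin (product_topology (\<lambda>_::'a. euclidean) UNIV) (PiE UNIV (\<lambda>_. S))"
    using assms by (subst compactin_PiE) simp
  moreover have "PiE UNIV (\<lambda>_::'a. S) = {f. \<forall>i. f i \<in> S}"
    by (auto simp: PiE_UNIV_domain)
  ultimately show ?thesis
    by (simp add: euclidean_product_topology)
qed

text \<open>Compactness of the product with the parameter interval yields a step length that serves
  all points of \<open>C\<close> at once.\<close>

lemma uniform_in_parameter:
  fixes \<Phi> :: "real \<Rightarrow> 'x::metric_space \<Rightarrow> 'y::metric_space"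
  assumes "continuous_on ({0..1} \<times> C) (\<lambda>(s, x). \<Phi> s x)" "compact C" "e > 0"
  obtains d where "d > 0"
    "\<And>s t x. s \<in> {0..1} \<Longrightarrow> t \<in> {0..1} \<Longrightarrow> x \<in> C \<Longrightarrow> \<bar>s - t\<bar> < d \<Longrightarrow> dist (\<Phi> s x) (\<Phi> t x) < e"
proof -
  have "uniformly_continuous_on ({0..1} \<times> C) (\<lambda>(s, x). \<Phi> s x)"
    using assms by (intro compact_uniformly_continuous compact_Times) auto
  then obtain d where d: "d > 0"
    "\<And>u v. u \<in> {0..1} \<times> C \<Longrightarrow> v \<in> {0..1} \<times> C \<Longrightarrow> dist v u < d \<Longrightarrow>
       dist (case v of (s, x) \<Rightarrow> \<Phi> s x) (case u of (s, x) \<Rightarrow> \<Phi> s x) < e"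
    using \<open>e > 0\<close> unfolding uniformly_continuous_on_def by metis
  show ?thesis
  proof (rule that[OF d(1)])
    fix s t x assume "s \<in> {0..1}" "t \<in> {0..1}" "x \<in> C" "\<bar>s - t\<bar> < d"
    then show "dist (\<Phi> s x) (\<Phi> t x) < e"
      using d(2)[of "(t, x)" "(s, x)"] by (simp add: dist_Pair_Pair dist_real_def)
  qed
qed

text \<open>The identity |1 + conj(x) z|^2 - |z + x|^2 = (1 - |x|^2)(1 - |z|^2) has a nonnegative
  right-hand side on the closed disc.\<close>

lemma norm_Blaschke_le:
  fixes x z :: complex
  assumes "norm x \<le> 1" "norm z \<le> 1"
  shows "norm (z + x) \<le> norm (1 + cnj x * z)"
proof -
  have "norm (1 + cnj x * z) ^ 2 - norm (z + x) ^ 2 = (1 - norm x ^ 2) * (1 - norm z ^ 2)"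
    unfolding cmod_power2 by (simp add: power2_eq_square algebra_simps)
  moreover have "(1 - norm x ^ 2) * (1 - norm z ^ 2) \<ge> 0"
    using assms by (intro mult_nonneg_nonneg) (auto simp: power_le_one)
  ultimately have "norm (z + x) ^ 2 \<le> norm (1 + cnj x * z) ^ 2" by linarith
  then show ?thesis by (rule power2_le_imp_le) simp
qed

text \<open>The right-hand side of the same identity vanishes on the unit circle.\<close>

lemma norm_Blaschke_eq:
  fixes x z :: complex
  assumes "norm z = 1"
  shows "norm (z + x) = norm (1 + cnj x * z)"
proof -
  have "norm (1 + cnj x * z) ^ 2 - norm (z + x) ^ 2 = (1 - norm x ^ 2) * (1 - norm z ^ 2)"
    unfolding cmod_power2 by (simp add: power2_eq_square algebra_simps)
  then have "norm (z + x) ^ 2 = norm (1 + cnj x * z) ^ 2" using assms by simp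
  then show ?thesis by (metis norm_ge_zero power2_eq_imp_eq)
qed

lemma Blaschke_denominator_nonzero:
  fixes x z :: complex
  assumes "norm x < 1" "norm z \<le> 1"
  shows "1 + cnj x * z \<noteq> 0"
proof
  assume "1 + cnj x * z = 0"
  then have "norm (cnj x * z) = 1" by (metis add_eq_0_iff norm_minus_cancel norm_one)
  moreover have "norm (cnj x * z) < 1"
    using assms mult_left_le[of "norm z" "norm x"] by (simp add: norm_mult)
  ultimately show False by simp
qed

text \<open>
  The disc \<open>z \<mapsto> ((z + x i) / (1 + cnj (x i) z))\<^sub>i\<close> passes through \<open>x\<close> at \<open>z = 0\<close> and maps the
  unit circle into the torus, so the one-variable maximum principle for \<open>1 / F\<close> suffices.
\<close>

lemma polydisc_minimum_modulus:
  fixes F :: "('i \<Rightarrow> complex) \<Rightarrow> complex"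
  assumes cont: "continuous_on UNIV F"
    and holo: "\<And>h. (\<And>i. h i holomorphic_on ball 0 1) \<Longrightarrow> (\<lambda>z. F (\<lambda>i. h i z)) holomorphic_on ball 0 1"
    and nz: "\<And>x. (\<And>i. norm (x i) \<le> 1) \<Longrightarrow> F x \<noteq> 0"
    and torus: "\<And>x. (\<And>i. norm (x i) = 1) \<Longrightarrow> norm (F x) \<ge> m"
    and m: "m > 0" and x: "\<And>i. norm (x i) \<le> 1"
  shows "norm (F x) \<ge> m"
proof -
  \<comment> \<open>For |x i| = 1 the quotient equals \<open>x i\<close> except at
    \<open>z = - x i\<close>, where it is 0/0; the constant is its continuous extension.\<close>
  define h where "h i z = (if norm (x i) = 1 then x i else (z + x i) / (1 + cnj (x i) * z))" for i z
  have lt: "norm (x i) < 1" if "norm (x i) \<noteq> 1" for i using x[of i] that by linarith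
  have hholo: "h i holomorphic_on ball 0 1" for i
    using Blaschke_denominator_nonzero[OF lt[of i]] unfolding h_def
    by (cases "norm (x i) = 1") (auto intro!: holomorphic_intros)
  have hcont: "continuous_on (cball 0 1) (h i)" for i
    using Blaschke_denominator_nonzero[OF lt[of i]] unfolding h_def
    by (cases "norm (x i) = 1") (auto intro!: continuous_intros)
  have hle: "norm (h i z) \<le> 1" if "norm z \<le> 1" for i z
    using norm_Blaschke_le[OF x[of i] that] unfolding h_def by (auto simp: norm_divide divide_le_eq)
  have heq: "norm (h i z) = 1" if "norm z = 1" for i z
    using norm_Blaschke_eq[OF that, of "x i"] Blaschke_denominator_nonzero[OF lt[of i], of z] that
    unfolding h_def by (auto simp: norm_divide)
  define q where "q z = inverse (F (\<lambda>i. h i z))" for z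
  have "norm (q 0) \<le> inverse m"
  proof (rule maximum_modulus_frontier[where f = q and S = "cball 0 1" and \<xi> = 0])
    show "q holomorphic_on interior (cball 0 1)" unfolding q_def
      using nz hle holo[OF hholo] by (auto intro!: holomorphic_intros simp: less_imp_le)
    have "continuous_on (cball 0 1) (\<lambda>z. F (\<lambda>i. h i z))"
      by (rule continuous_on_compose2[OF cont]) (auto intro!: continuous_on_coordinatewise_then_product hcont)
    then show "continuous_on (closure (cball 0 1)) q" unfolding q_def
      using nz hle by (auto intro!: continuous_intros)
    show "norm (q z) \<le> inverse m" if "z \<in> frontier (cball 0 1)" for z
      using that torus[of "\<lambda>i. h i z"] heq[of z] m
      by (simp add: q_def norm_inverse le_imp_inverse_le frontier_cball)
  qed auto
  moreover have "h i 0 = x i" for i by (simp add: h_def)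
  ultimately have "inverse (norm (F x)) \<le> inverse m" by (simp add: q_def norm_inverse)
  moreover have "norm (F x) > 0" using nz[OF x] by simp
  ultimately show ?thesis using m by (simp add: inverse_le_iff)
qed

text \<open>
  Nonvanishing propagates in small steps of \<open>\<sigma>\<close> from the centre \<open>\<sigma> = 0\<close>: on each polydisc where
  \<open>G\<close> has no zero, it is bounded below by its minimum over the tori, which is a uniform bound.
\<close>

lemma polydisc_nonzero:
  fixes G :: "('i::countable \<Rightarrow> complex) \<Rightarrow> complex"
  assumes cont: "continuous_on UNIV G"
    and holo: "\<And>h. (\<And>i. h i holomorphic_on ball 0 1) \<Longrightarrow> (\<lambda>z. G (\<lambda>i. h i z)) holomorphic_on ball 0 1"
    and p: "\<And>i. p i > 0"
    and tori: "\<And>\<sigma> x. \<sigma> \<in> {0..1} \<Longrightarrow> (\<And>i. norm (x i) = 1) \<Longrightarrow>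
                 G (\<lambda>i. complex_of_real (\<sigma> powr p i) * x i) \<noteq> 0"
    and x: "\<And>i. norm (x i) \<le> 1"
  shows "G x \<noteq> 0"
proof -
  define \<Psi> where "\<Psi> \<sigma> x = G (\<lambda>i. complex_of_real (\<sigma> powr p i) * x i)" for \<sigma> x
  define T where "T = {x :: 'i \<Rightarrow> complex. \<forall>i. x i \<in> sphere 0 1}"
  define Q where "Q = {x :: 'i \<Rightarrow> complex. \<forall>i. x i \<in> cball 0 1}"
  have \<Psi>cont: "continuous_on ({0..1} \<times> A) (\<lambda>(\<sigma>, x). \<Psi> \<sigma> x)" for A
    unfolding \<Psi>_def case_prod_beta
    by (rule continuous_on_compose2[OF cont])
       (auto intro!: continuous_on_coordinatewise_then_product continuous_intros continuous_on_powr' p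
          intro: continuous_on_product_then_coordinatewise[OF continuous_on_snd[OF continuous_on_id]])
  have "compact T" "compact Q"
    unfolding T_def Q_def by (rule compact_functions_into, simp)+
  have one: "(\<lambda>_. 1) \<in> T" by (simp add: T_def)
  have "continuous_on ({0..1} \<times> T) (\<lambda>y. norm (case y of (\<sigma>, x) \<Rightarrow> \<Psi> \<sigma> x))"
    by (intro continuous_on_norm \<Psi>cont)
  from continuous_attains_inf[OF _ _ this] \<open>compact T\<close> one
  obtain \<sigma>\<^sub>0 x\<^sub>0 where min: "\<sigma>\<^sub>0 \<in> {0..1}" "x\<^sub>0 \<in> T"
      "\<And>\<sigma> x. \<sigma> \<in> {0..1} \<Longrightarrow> x \<in> T \<Longrightarrow> norm (\<Psi> \<sigma>\<^sub>0 x\<^sub>0) \<le> norm (\<Psi> \<sigma> x)"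
    by (force simp: compact_Times)
  define m where "m = norm (\<Psi> \<sigma>\<^sub>0 x\<^sub>0)"
  have "m > 0" using min tori[of \<sigma>\<^sub>0 x\<^sub>0] by (simp add: m_def \<Psi>_def T_def)
  have mT: "m \<le> norm (\<Psi> \<sigma> x)" if "\<sigma> \<in> {0..1}" "x \<in> T" for \<sigma> x
    using min(3)[OF that] by (simp add: m_def)
  obtain d where d: "d > 0"
    "\<And>s t x. s \<in> {0..1} \<Longrightarrow> t \<in> {0..1} \<Longrightarrow> x \<in> Q \<Longrightarrow> \<bar>s - t\<bar> < d \<Longrightarrow> dist (\<Psi> s x) (\<Psi> t x) < m"
    using uniform_in_parameter[OF \<Psi>cont \<open>compact Q\<close> \<open>m > 0\<close>] by blast
  obtain N where N: "inverse (real (Suc N)) < d" using reals_Archimedean[OF d(1)] by blast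
  have "\<forall>x\<in>Q. m \<le> norm (\<Psi> (real n / real (Suc N)) x)" if "n \<le> Suc N" for n
    using that
  proof (induction n)
    case 0
    \<comment> \<open>All radii \<open>0 powr p i\<close> are 0, so the value at the centre already
      belongs to the family of tori; this starts the bound by \<open>m\<close>.\<close>
    have "\<Psi> 0 x = \<Psi> 0 (\<lambda>_. 1)" for x by (simp add: \<Psi>_def)
    then show ?case using mT[of 0, OF _ one] by (metis atLeastAtMost_iff div_0 of_nat_0 order_refl zero_le_one)
  next
    case (Suc n)
    define s where "s = real n / real (Suc N)"
    define t where "t = real (Suc n) / real (Suc N)"
    have s: "s \<in> {0..1}" "t \<in> {0..1}" using Suc.prems by (auto simp: s_def t_def field_simps)
    have "t - s = inverse (real (Suc N))" by (simp add: s_def t_def field_simps)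
    then have st: "\<bar>s - t\<bar> < d" using N by (smt (verit) inverse_nonnegative_iff_nonnegative of_nat_0_le_iff)
    \<comment> \<open>One step changes the value by less than \<open>m\<close>, which only excludes
      zeros; the minimum modulus principle then restores the full bound \<open>m\<close>, so nothing
      is lost from step to step.\<close>
    have nz: "\<Psi> t x \<noteq> 0" if "x \<in> Q" for x
    proof
      assume "\<Psi> t x = 0"
      then have "norm (\<Psi> s x) < m" using d(2)[OF s that st] by simp
      then show False using Suc that by (force simp: s_def)
    qed
    have "m \<le> norm (\<Psi> t x)" if "x \<in> Q" for x
    proof (rule polydisc_minimum_modulus[where F = "\<Psi> t"])
      show "continuous_on UNIV (\<Psi> t)" unfolding \<Psi>_def
        by (rule continuous_on_compose2[OF cont])
           (auto intro!: continuous_on_coordinatewise_then_product continuous_intros)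
      show "(\<lambda>z. \<Psi> t (\<lambda>i. h i z)) holomorphic_on ball 0 1"
        if "\<And>i. h i holomorphic_on ball 0 1" for h unfolding \<Psi>_def
        by (rule holo) (intro holomorphic_intros that)
    qed (use nz mT[OF s(2)] \<open>m > 0\<close> that in \<open>auto simp: Q_def T_def\<close>)
    then show ?case by (simp add: t_def)
  qed
  from this[of "Suc N"] have "\<forall>x\<in>Q. m \<le> norm (\<Psi> 1 x)" by simp
  moreover have "\<Psi> 1 x = G x" by (simp add: \<Psi>_def)
  moreover have "x \<in> Q" using x by (simp add: Q_def)
  ultimately show ?thesis using \<open>m > 0\<close> by fastforce
qed

text \<open>The modulus at parameter 0 has a positive minimum over the compact set, and a short
  parameter step cannot use it up. In this form it absorbs perturbations of radii, kernel values and
  delays alike.\<close>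

lemma nonzero_for_small_parameter:
  fixes \<Phi> :: "real \<Rightarrow> 'x::metric_space \<Rightarrow> complex"
  assumes cont: "continuous_on ({0..1} \<times> C) (\<lambda>(s, x). \<Phi> s x)" and "compact C"
    and nz: "\<And>x. x \<in> C \<Longrightarrow> \<Phi> 0 x \<noteq> 0"
  obtains d where "0 < d" "d \<le> 1" "\<And>s x. s \<in> {0..d} \<Longrightarrow> x \<in> C \<Longrightarrow> \<Phi> s x \<noteq> 0"
proof (cases "C = {}")
  case True
  then show ?thesis using that[of 1] by auto
next
  case False
  have "continuous_on C (\<lambda>x. norm (case (0, x) of (s, x) \<Rightarrow> \<Phi> s x))"
    by (intro continuous_on_norm continuous_on_compose2[OF cont] continuous_intros) auto
  from continuous_attains_inf[OF \<open>compact C\<close> False this]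
  obtain x\<^sub>0 where x\<^sub>0: "x\<^sub>0 \<in> C" "\<And>x. x \<in> C \<Longrightarrow> norm (\<Phi> 0 x\<^sub>0) \<le> norm (\<Phi> 0 x)" by auto
  then have "norm (\<Phi> 0 x\<^sub>0) > 0" using nz by simp
  then obtain d where d: "d > 0"
    "\<And>s t x. s \<in> {0..1} \<Longrightarrow> t \<in> {0..1} \<Longrightarrow> x \<in> C \<Longrightarrow> \<bar>s - t\<bar> < d \<Longrightarrow>
       dist (\<Phi> s x) (\<Phi> t x) < norm (\<Phi> 0 x\<^sub>0)"
    using uniform_in_parameter[OF cont \<open>compact C\<close>] by blast
  show ?thesis
  proof (rule that[of "min 1 (d / 2)"])
    fix s x assume s: "s \<in> {0..min 1 (d / 2)}" and x: "x \<in> C"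
    then have "dist (\<Phi> s x) (\<Phi> 0 x) < norm (\<Phi> 0 x\<^sub>0)" using d by (intro d(2)) auto
    then show "\<Phi> s x \<noteq> 0" using x\<^sub>0(2)[OF x] by auto
  qed (use d in auto)
qed

section \<open>The kernel transform\<close>

lemma holomorphic_exp_integral:
  fixes f :: "real \<Rightarrow> complex"
  assumes "continuous_on {p..q} f"
  shows "(\<lambda>z. integral {p..q} (\<lambda>t. f t * exp (z * of_real t))) holomorphic_on UNIV"
proof -
  have f: "continuous_on (cbox p q) f" using assms by simp
  have "(\<lambda>z. integral (cbox p q) (\<lambda>t. f t * exp (z * of_real t))) holomorphic_on UNIV"
  proof (rule leibniz_rule_holomorphic)
    show "((\<lambda>z. f t * exp (z * of_real t)) has_field_derivative f t * (exp (z * of_real t) * of_real t))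
        (at z within UNIV)" for z t
      by (auto intro!: derivative_eq_intros)
    show "(\<lambda>t. f t * exp (z * of_real t)) integrable_on cbox p q" for z
      using f by (intro integrable_continuous continuous_intros)
    have "continuous_on (UNIV \<times> cbox p q) (\<lambda>x::complex \<times> real. f (snd x))"
      by (rule continuous_on_compose2[OF assms]) (auto intro: continuous_on_snd continuous_on_id)
    then show "continuous_on (UNIV \<times> cbox p q)
        (\<lambda>(z, t). f t * (exp (z * of_real t) * of_real t))"
      unfolding case_prod_beta by (auto intro!: continuous_intros)
  qed auto
  then show ?thesis by simp
qed

text \<open>On a right half plane the exponential is bounded over a compact interval of nonpositive
  times. In the integration by parts, the bound on the integrand serves the boundary terms and the
  bound on the integral serves the remainder.\<close>

lemma norm_exp_integral_le:
  fixes f :: "real \<Rightarrow> complex"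
  assumes "continuous_on {p..q} f" "p \<le> q" "q \<le> 0"
  obtains C where "\<And>z. Re z \<ge> - \<beta> \<Longrightarrow> norm (integral {p..q} (\<lambda>t. f t * exp (z * of_real t))) \<le> C"
    "\<And>z t. Re z \<ge> - \<beta> \<Longrightarrow> t \<in> {p..q} \<Longrightarrow> norm (f t * exp (z * of_real t)) \<le> C"
proof -
  have "bounded (f ` {p..q})"
    using assms by (intro compact_imp_bounded compact_continuous_image) auto
  then obtain B where B: "B > 0" "\<And>t. t \<in> {p..q} \<Longrightarrow> norm (f t) \<le> B"
    unfolding bounded_pos by auto
  define E where "E = exp (\<bar>\<beta>\<bar> * - p)"
  have fE: "norm (f t * exp (z * of_real t)) \<le> B * E" if "Re z \<ge> - \<beta>" "t \<in> {p..q}" for z t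
  proof -
    have t: "p \<le> t" "t \<le> 0" using that assms by auto
    have "Re z * t \<le> - \<bar>\<beta>\<bar> * t"
      by (rule mult_right_mono_neg) (use that t in auto)
    also have "\<dots> \<le> \<bar>\<beta>\<bar> * - p" using t mult_left_mono[of "-t" "-p" "\<bar>\<beta>\<bar>"] by auto
    finally have "norm (exp (z * of_real t)) \<le> E" by (simp add: E_def norm_exp_eq_Re)
    then show ?thesis using B that by (auto simp: norm_mult intro!: mult_mono)
  qed
  have int: "norm (integral {p..q} (\<lambda>t. f t * exp (z * of_real t))) \<le> B * E * (q - p)"
    if "Re z \<ge> - \<beta>" for z
  proof (rule integral_bound)
    show "continuous_on {p..q} (\<lambda>t. f t * exp (z * of_real t))"
      using assms by (auto intro!: continuous_intros)
  qed (use assms fE that in auto)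
  show ?thesis
    using int fE that[of "max (B * E * (q - p)) (B * E)"] by (meson le_max_iff_disj)
qed

text \<open>Integration by parts, in the form \<open>z \<integral> g(t) e\<^bsup>zt\<^esup> dt = [g(t) e\<^bsup>zt\<^esup>] - \<integral> g'(t) e\<^bsup>zt\<^esup> dt\<close>.\<close>

lemma C1_exp_integral_decay:
  fixes g :: "real \<Rightarrow> real"
  assumes g: "g C1_differentiable_on {p..q}" and "p \<le> q" "q \<le> 0"
  shows "\<exists>C. \<forall>z. Re z \<ge> - \<beta> \<longrightarrow>
           norm z * norm (integral {p..q} (\<lambda>t. complex_of_real (g t) * exp (z * of_real t))) \<le> C"
proof -
  obtain D where D: "\<And>t. t \<in> {p..q} \<Longrightarrow> (g has_vector_derivative D t) (at t)"
    and Dc: "continuous_on {p..q} D"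
    using g unfolding C1_differentiable_on_def by blast
  have gc: "continuous_on {p..q} g"
    using D by (meson continuous_at_imp_continuous_on has_vector_derivative_continuous)
  have gc': "continuous_on {p..q} (\<lambda>t. complex_of_real (g t))"
    and Dc': "continuous_on {p..q} (\<lambda>t. complex_of_real (D t))"
    using gc Dc by (auto intro!: continuous_intros)
  obtain C1 where C1: "\<And>z t. Re z \<ge> - \<beta> \<Longrightarrow> t \<in> {p..q} \<Longrightarrow>
      norm (complex_of_real (g t) * exp (z * of_real t)) \<le> C1"
    using norm_exp_integral_le[OF gc' assms(2,3)] by metis
  obtain C2 where C2: "\<And>z. Re z \<ge> - \<beta> \<Longrightarrow>
      norm (integral {p..q} (\<lambda>t. complex_of_real (D t) * exp (z * of_real t))) \<le> C2"
    using norm_exp_integral_le[OF Dc' assms(2,3)] by metis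
  have "norm z * norm (integral {p..q} (\<lambda>t. complex_of_real (g t) * exp (z * of_real t))) \<le> 2 * C1 + C2"
    if z: "Re z \<ge> - \<beta>" for z
  proof -
    define J where "J = integral {p..q} (\<lambda>t. complex_of_real (g t) * exp (z * of_real t))"
    define J' where "J' = integral {p..q} (\<lambda>t. complex_of_real (D t) * exp (z * of_real t))"
    define e where "e t = complex_of_real (g t) * exp (z * of_real t)" for t
    have "((\<lambda>t. complex_of_real (D t) * exp (z * of_real t) + z * (complex_of_real (g t) * exp (z * of_real t)))
        has_integral e q - e p) {p..q}"
    proof (rule fundamental_theorem_of_calculus[OF \<open>p \<le> q\<close>])
      fix t assume "t \<in> {p..q}"
      then have "((\<lambda>t. complex_of_real (g t)) has_vector_derivative complex_of_real (D t)) (at t within {p..q})"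
        using D 
        by (intro has_vector_derivative_of_real)
           (simp add: has_real_derivative_iff_has_vector_derivative has_vector_derivative_at_within)
      moreover have "((\<lambda>t. exp (z * of_real t)) has_vector_derivative z * exp (z * of_real t)) (at t within {p..q})"
        by (rule has_vector_derivative_real_field) (auto intro!: derivative_eq_intros)
      ultimately show "(e has_vector_derivative complex_of_real (D t) * exp (z * of_real t)
            + z * (complex_of_real (g t) * exp (z * of_real t))) (at t within {p..q})"
        unfolding e_def by (rule has_vector_derivative_mult[THEN has_vector_derivative_eq_rhs]) (simp add: algebra_simps)
    qed
    moreover have "((\<lambda>t. complex_of_real (D t) * exp (z * of_real t) + z * (complex_of_real (g t) * exp (z * of_real t)))
        has_integral J' + z * J) {p..q}"
      unfolding J_def J'_def using gc' Dc'
      by (intro has_integral_add has_integral_mult_right integrable_integral integrable_continuous_real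
            continuous_on_mult continuous_on_exp continuous_on_const continuous_on_of_real_id)
    ultimately have "e q - e p = J' + z * J" by (rule has_integral_unique)
    then have "z * J = e q - e p - J'" by (simp add: algebra_simps)
    then have "norm z * norm J = norm (e q - e p - J')" by (simp flip: norm_mult)
    also have "\<dots> \<le> norm (e q) + norm (e p) + norm J'"
      using norm_triangle_ineq4[of "e q - e p" J'] norm_triangle_ineq4[of "e q" "e p"] by linarith
    finally have "norm z * norm J \<le> norm (e q) + norm (e p) + norm J'" .
    then show ?thesis
      using C1[OF z, of q] C1[OF z, of p] C2[OF z] \<open>p \<le> q\<close> by (simp add: J_def J'_def e_def)
  qed
  then show ?thesis by blast
qed

text \<open>The smooth pieces are summed; the breakpoints, where \<open>f\<close> is arbitrary, form
  a finite set and do not affect the integral. Every entry of the kernel transform is thus entire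
  and O(1/|z|) on right half planes.\<close>

lemma piecewise_C1_exp_integral:
  assumes f: "piecewise_C1_on f a b" and b: "b \<le> 0"
  defines "J \<equiv> \<lambda>z. integral {a..b} (\<lambda>t. complex_of_real (f t) * exp (z * of_real t))"
  shows "J holomorphic_on UNIV"
    and "\<exists>C. \<forall>z. Re z \<ge> - \<beta> \<longrightarrow> norm z * norm (J z) \<le> C"
proof -
  obtain m p where p: "p 0 = a" "p m = b"
    and pieces: "\<And>i. i < m \<Longrightarrow> p i < p (Suc i) \<and> (\<exists>g. g C1_differentiable_on {p i..p (Suc i)} \<and>
                (\<forall>t\<in>{p i<..<p (Suc i)}. f t = g t))"
    using f unfolding piecewise_C1_on_def by blast
  \<comment> \<open>Going down from \<open>p m = b\<close>, every breakpoint is nonpositive, which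
    the decay estimate asks of each piece.\<close>
  have neg: "p n \<le> 0" if "n \<le> m" for n
    using that
  proof (induction rule: inc_induct)
    case base
    then show ?case using p b by simp
  next
    case (step n)
    then show ?case using pieces[of n] by force
  qed
  have "a \<le> p n \<and> (\<exists>J. J holomorphic_on UNIV \<and> (\<exists>C. \<forall>z. Re z \<ge> - \<beta> \<longrightarrow> norm z * norm (J z) \<le> C) \<and>
          (\<forall>z. ((\<lambda>t. complex_of_real (f t) * exp (z * of_real t)) has_integral J z) {a..p n}))"
    if "n \<le> m" for n
    using that
  proof (induction n)
    case 0
    then show ?case using p by (auto intro!: exI[of _ "\<lambda>_. 0"] exI[of _ 0])
  next
    case (Suc n)
    then obtain J C where J: "a \<le> p n" "J holomorphic_on UNIV"
      "\<And>z. Re z \<ge> - \<beta> \<Longrightarrow> norm z * norm (J z) \<le> C"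
      "\<And>z. ((\<lambda>t. complex_of_real (f t) * exp (z * of_real t)) has_integral J z) {a..p n}"
      by auto
    obtain g where g: "p n < p (Suc n)" "g C1_differentiable_on {p n..p (Suc n)}"
      "\<And>t. t \<in> {p n<..<p (Suc n)} \<Longrightarrow> f t = g t"
      using pieces[of n] Suc.prems by auto
    define I where "I z = integral {p n..p (Suc n)} (\<lambda>t. complex_of_real (g t) * exp (z * of_real t))" for z
    have "continuous_on {p n..p (Suc n)} g"
      using g(2) by (rule C1_differentiable_imp_continuous_on)
    then have gc: "continuous_on {p n..p (Suc n)} (\<lambda>t. complex_of_real (g t))"
      by (intro continuous_intros)
    obtain C' where C': "\<And>z. Re z \<ge> - \<beta> \<Longrightarrow> norm z * norm (I z) \<le> C'"
      using C1_exp_integral_decay[OF g(2), of \<beta>] g(1) neg[OF Suc.prems] unfolding I_def by auto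
    have hI: "((\<lambda>t. complex_of_real (f t) * exp (z * of_real t)) has_integral I z) {p n..p (Suc n)}" for z
    proof (rule has_integral_spike_finite[where S = "{p n, p (Suc n)}"])
      show "((\<lambda>t. complex_of_real (g t) * exp (z * of_real t)) has_integral I z) {p n..p (Suc n)}"
        unfolding I_def using gc
        by (intro integrable_integral integrable_continuous_real continuous_on_mult continuous_on_exp
              continuous_on_const continuous_on_of_real_id)
    qed (use g(3) in auto)
    have "norm z * norm (J z + I z) \<le> C + C'" if "Re z \<ge> - \<beta>" for z
      using J(3)[OF that] C'[OF that] norm_triangle_ineq[of "J z" "I z"]
      by (smt (verit) distrib_left mult_left_mono norm_ge_zero)
    moreover have "(\<lambda>z. J z + I z) holomorphic_on UNIV"
      using J(2) holomorphic_exp_integral[OF gc] unfolding I_def by (intro holomorphic_on_add)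
    moreover have "((\<lambda>t. complex_of_real (f t) * exp (z * of_real t)) has_integral J z + I z) {a..p (Suc n)}" for z
      using has_integral_combine[OF J(1) _ J(4) hI] g(1) by simp
    ultimately show ?case using J(1) g(1) by (intro conjI exI[of _ "\<lambda>z. J z + I z"]) auto
  qed
  from this[of m] p obtain J' where "J' holomorphic_on UNIV"
      "\<exists>C. \<forall>z. Re z \<ge> - \<beta> \<longrightarrow> norm z * norm (J' z) \<le> C"
      "\<And>z. ((\<lambda>t. complex_of_real (f t) * exp (z * of_real t)) has_integral J' z) {a..b}"
    by auto
  moreover from this have "J = J'" unfolding J_def by (auto simp: integral_unique)
  ultimately show "J holomorphic_on UNIV"
    and "\<exists>C. \<forall>z. Re z \<ge> - \<beta> \<longrightarrow> norm z * norm (J z) \<le> C" by auto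
qed

section \<open>The characteristic determinant\<close>

text \<open>
  With \<open>c (Inl i) = exp (- z r\<^sub>i)\<close> and \<open>c (Inr j) = exp (- z s\<^sub>j)\<close> this is the characteristic determinant, with
  the transform of the kernel replaced by an independent variable \<open>\<kappa>\<close>. The index type \<open>nat + nat\<close> makes
  all exponentials one point of a countable power of the complex plane, in which polydiscs are compact.
\<close>

definition char_det ::
    "nat \<Rightarrow> nat \<Rightarrow> (nat \<Rightarrow> nat \<Rightarrow> real mat) \<Rightarrow> (nat + nat \<Rightarrow> complex) \<Rightarrow> (nat \<times> nat \<Rightarrow> complex) \<Rightarrow> complex" where
  "char_det k l H c \<kappa> = (\<Sum>\<pi> | \<pi> permutes {0..<l}. signof \<pi> * (\<Prod>a = 0..<l.
     (if a = \<pi> a then - 1 else 0)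
     + (\<Sum>i=1..k. \<Sum>j=1..l. complex_of_real (H i j $$ (a, \<pi> a)) * (c (Inl i) * c (Inr j)))
     + \<kappa> (a, \<pi> a)))"

lemma char_det_cong:
  assumes "\<And>i. i \<in> {1..k} \<Longrightarrow> c (Inl i) = c' (Inl i)" "\<And>j. j \<in> {1..l} \<Longrightarrow> c (Inr j) = c' (Inr j)"
    and "\<And>a b. a < l \<Longrightarrow> b < l \<Longrightarrow> \<kappa> (a, b) = \<kappa>' (a, b)"
  shows "char_det k l H c \<kappa> = char_det k l H c' \<kappa>'"
  unfolding char_det_def
proof (intro sum.cong refl arg_cong2[where f = "(*)"] prod.cong arg_cong2[where f = "(+)"])
  fix \<pi> a assume "\<pi> \<in> {\<pi>. \<pi> permutes {0..<l}}" "a \<in> {0..<l}"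
  then show "\<kappa> (a, \<pi> a) = \<kappa>' (a, \<pi> a)"
    using assms(3)[of a "\<pi> a"] permutes_in_image[of \<pi> "{0..<l}" a] by auto
qed (use assms in auto)

lemma continuous_on_char_det:
  assumes "\<And>i. continuous_on S (\<lambda>x. c x i)" "\<And>i. continuous_on S (\<lambda>x. \<kappa> x i)"
  shows "continuous_on S (\<lambda>x. char_det k l H (c x) (\<kappa> x))"
  unfolding char_det_def by (intro continuous_intros assms)

lemma holomorphic_on_char_det:
  assumes "\<And>i. (\<lambda>x. c x i) holomorphic_on S" "\<And>i. (\<lambda>x. \<kappa> x i) holomorphic_on S"
  shows "(\<lambda>x. char_det k l H (c x) (\<kappa> x)) holomorphic_on S"
  unfolding char_det_def by (intro holomorphic_intros assms)

lemma tendsto_char_det: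
  assumes "\<And>i. ((\<lambda>x. c x i) \<longlongrightarrow> c' i) F"
  shows "((\<lambda>x. char_det k l H (c x) \<kappa>) \<longlongrightarrow> char_det k l H c' \<kappa>) F"
  unfolding char_det_def by (intro tendsto_intros assms)

text \<open>The Leibniz formula turns the determinant into a polynomial in scalars, for which
  continuity and holomorphy are immediate.\<close>

lemma det_weighted_sum:
  assumes "K \<in> carrier_mat l l"
    and "\<And>i j. i \<in> {1..k} \<Longrightarrow> j \<in> {1..l} \<Longrightarrow> w i j = c (Inl i) * c (Inr j)"
  shows "det (- 1\<^sub>m l + weighted_sum k l H w + K) = char_det k l H c (\<lambda>p. K $$ p)"
proof -
  define A where "A = - 1\<^sub>m l + weighted_sum k l H w + K"
  have A: "A \<in> carrier_mat l l" using assms by (auto simp: A_def weighted_sum_def)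
  have "A $$ (a, b) = (if a = b then - 1 else 0)
     + (\<Sum>i=1..k. \<Sum>j=1..l. complex_of_real (H i j $$ (a, b)) * (c (Inl i) * c (Inr j))) + K $$ (a, b)"
    if "a < l" "b < l" for a b
    using that assms by (simp add: A_def weighted_sum_def)
  then have "det A = char_det k l H c (\<lambda>p. K $$ p)"
    unfolding det_def'[OF A] char_det_def
    by (intro sum.cong refl arg_cong2[where f = "(*)"] prod.cong)
       (use permutes_in_image in fastforce)
  then show ?thesis by (simp add: A_def)
qed

text \<open>At the centre the matrix is -I. All continuation arguments start from this
  point.\<close>

lemma char_det_zero: "char_det k l H (\<lambda>_. 0) (\<lambda>_. 0) \<noteq> 0"
proof -
  have "char_det k l H (\<lambda>_. 0) (\<lambda>_. 0) = char_det k l H (\<lambda>_. 0) (\<lambda>p. 0\<^sub>m l l $$ p)"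
    by (rule char_det_cong) auto
  also have "\<dots> = det (- 1\<^sub>m l + weighted_sum k l H (\<lambda>_ _. 0) + 0\<^sub>m l l)"
    by (rule det_weighted_sum[symmetric]) auto
  also have "- 1\<^sub>m l + weighted_sum k l H (\<lambda>_ _. 0) + 0\<^sub>m l l = (- 1) \<cdot>\<^sub>m (1\<^sub>m l :: complex mat)"
    by (rule eq_matI) (auto simp: weighted_sum_def)
  finally show ?thesis by simp
qed

section \<open>Spectral radius and zeros on polydiscs\<close>

text \<open>Since -I + \<mu> W = \<mu> (W - (1/\<mu>) I), the vanishing of the determinant is an
  eigenvalue condition on W.\<close>

lemma char_det_eq_0_iff_eigenvalue:
  assumes "\<And>i j. c (Inl i) * c (Inr j) = \<mu> * (d (Inl i) * d (Inr j))" "\<mu> \<noteq> 0"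
  shows "char_det k l H c (\<lambda>_. 0) = 0 \<longleftrightarrow>
           eigenvalue (weighted_sum k l H (\<lambda>i j. d (Inl i) * d (Inr j))) (1 / \<mu>)"
proof -
  define W where "W = weighted_sum k l H (\<lambda>i j. d (Inl i) * d (Inr j))"
  have W: "W \<in> carrier_mat l l" by (auto simp: W_def weighted_sum_def)
  have "char_det k l H c (\<lambda>_. 0) = char_det k l H c (\<lambda>p. 0\<^sub>m l l $$ p)"
    by (rule char_det_cong) auto
  also have "\<dots> = det (- 1\<^sub>m l + weighted_sum k l H (\<lambda>i j. c (Inl i) * c (Inr j)) + 0\<^sub>m l l)"
    by (rule det_weighted_sum[symmetric]) auto
  also have "- 1\<^sub>m l + weighted_sum k l H (\<lambda>i j. c (Inl i) * c (Inr j)) + 0\<^sub>m l l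
      = \<mu> \<cdot>\<^sub>m char_matrix W (1 / \<mu>)"
    using assms by (intro eq_matI)
      (auto simp: W_def weighted_sum_def char_matrix_def algebra_simps sum_distrib_left)
  finally show ?thesis
    using W assms(2) by (simp add: eigenvalue_det W_def)
qed

text \<open>An eigenvalue \<open>e\<close> of modulus at least 1/R^2 would produce a zero in the
  polydisc of radius R: only products of an \<open>Inl\<close> and an \<open>Inr\<close> variable
  enter, so the factor 1/e can be distributed over the two groups.\<close>

lemma spectral_radius_less:
  assumes "l \<ge> 1" "R > 0" and nz: "\<And>c. (\<And>i. norm (c i) \<le> R) \<Longrightarrow> char_det k l H c (\<lambda>_. 0) \<noteq> 0"
    and d: "\<And>i. norm (d i) = 1"
  shows "spectral_radius (weighted_sum k l H (\<lambda>i j. d (Inl i) * d (Inr j))) < 1 / R\<^sup>2"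
proof (rule ccontr)
  define W where "W = weighted_sum k l H (\<lambda>i j. d (Inl i) * d (Inr j))"
  assume "\<not> ?thesis"
  moreover have W: "W \<in> carrier_mat l l" by (auto simp: W_def weighted_sum_def)
  ultimately obtain e where e: "eigenvalue W e" "norm e \<ge> 1 / R\<^sup>2"
    using spectral_radius_mem_max(1)[of W l] \<open>l \<ge> 1\<close> by (auto simp: W_def spectrum_def)
  have "0 < 1 / R\<^sup>2" using \<open>R > 0\<close> by simp
  then have "e \<noteq> 0" using e(2) by (auto simp del: zero_less_divide_1_iff)
  \<comment> \<open>The products are \<open>d (Inl i) * d (Inr j) / e\<close>. The second group has
    modulus R, and the first has modulus 1/(|e| R), which is at most R because |e| is at least
    1/R^2.\<close>
  define c where "c = case_sum (\<lambda>i. d (Inl i) / (e * of_real R)) (\<lambda>j. of_real R * d (Inr j))"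
  have "char_det k l H c (\<lambda>_. 0) = 0"
    using char_det_eq_0_iff_eigenvalue[of c "1 / e" d k l H] e \<open>e \<noteq> 0\<close> \<open>R > 0\<close> by (auto simp: c_def W_def)
  moreover have "norm (c i) \<le> R" for i
  proof (cases i)
    case (Inl a)
    have "1 \<le> R * R * norm e" using e(2) \<open>R > 0\<close> by (simp add: field_simps power2_eq_square)
    then show ?thesis using Inl d \<open>R > 0\<close> \<open>e \<noteq> 0\<close>
      by (simp add: c_def norm_divide norm_mult field_simps)
  next
    case (Inr b)
    then show ?thesis using d \<open>R > 0\<close> by (simp add: c_def norm_mult)
  qed
  ultimately show False using nz by blast
qed

text \<open>Polar form: pairs of angle vectors and unimodular families parametrise the same torus,
  and e^(i(\<theta>+\<nu>)) splits into a product.\<close>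

lemma gamma0_torus:
  "gamma0 k l H = Sup {spectral_radius (weighted_sum k l H (\<lambda>i j. d (Inl i) * d (Inr j))) | d.
     \<forall>i. norm (d i) = 1}" (is "_ = Sup ?B")
proof -
  let ?A = "{spectral_radius (weighted_sum k l H (\<lambda>i j. exp (\<i> * complex_of_real (\<theta> i + \<nu> j))))
          | \<theta> \<nu>. (\<forall>i\<in>{1..k}. \<theta> i \<in> {0..2 * pi}) \<and> (\<forall>j\<in>{1..l}. \<nu> j \<in> {0..2 * pi})}"
  have "x \<in> ?B" if "x \<in> ?A" for x
  proof -
    from that obtain \<theta> \<nu> where
      "x = spectral_radius (weighted_sum k l H (\<lambda>i j. exp (\<i> * complex_of_real (\<theta> i + \<nu> j))))" by auto
    then show ?thesis
      by (intro CollectI exI[of _ "case_sum (\<lambda>i. exp (\<i> * complex_of_real (\<theta> i))) (\<lambda>j. exp (\<i> * complex_of_real (\<nu> j)))"])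
         (auto simp: exp_add distrib_left split: sum.split)
  qed
  moreover have "x \<in> ?A" if "x \<in> ?B" for x
  proof -
    from that obtain d where d: "\<And>i. norm (d i) = 1"
      "x = spectral_radius (weighted_sum k l H (\<lambda>i j. d (Inl i) * d (Inr j)))" by auto
    have "d i = exp (\<i> * complex_of_real (Arg2pi (d i)))" for i
      using Arg2pi_eq[of "d i"] d(1)[of i] by simp
    then have "d (Inl i) * d (Inr j) = exp (\<i> * complex_of_real (Arg2pi (d (Inl i)) + Arg2pi (d (Inr j))))" for i j
      by (metis distrib_left exp_add of_real_add)
    then show ?thesis
      using d(2) Arg2pi_ge_0 Arg2pi_lt_2pi
      by (intro CollectI exI[of _ "\<lambda>i. Arg2pi (d (Inl i))"] exI[of _ "\<lambda>j. Arg2pi (d (Inr j))"])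
         (auto simp: less_imp_le)
  qed
  ultimately show ?thesis unfolding gamma0_def by (metis (no_types, lifting) subsetI subset_antisym)
qed

text \<open>Near the centre there is no zero, so \<open>spectral_radius_less\<close> with a small R
  bounds all the radii by 1/R^2. Boundedness is what makes the real supremum \<open>gamma0\<close>
  an upper bound of its members.\<close>

lemma bdd_above_spectral_radius:
  assumes "l \<ge> 1"
  shows "bdd_above {spectral_radius (weighted_sum k l H (\<lambda>i j. d (Inl i) * d (Inr j))) | d.
     \<forall>i. norm (d i) = 1}"
proof -
  define Q where "Q = {x :: nat + nat \<Rightarrow> complex. \<forall>i. x i \<in> cball 0 1}"
  have "compact Q" unfolding Q_def by (rule compact_functions_into) simp
  have "continuous_on ({0..1} \<times> Q) (\<lambda>(s::real, c). char_det k l H (\<lambda>i. of_real s * c i) (\<lambda>_. 0))"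
    unfolding case_prod_beta
    by (intro continuous_on_char_det continuous_intros
          continuous_on_product_then_coordinatewise[OF continuous_on_snd[OF continuous_on_id]])
  then obtain R where R: "R > 0" "R \<le> 1"
    "\<And>s c. s \<in> {0..R} \<Longrightarrow> c \<in> Q \<Longrightarrow> char_det k l H (\<lambda>i. of_real s * c i) (\<lambda>_. 0) \<noteq> 0"
    by (rule nonzero_for_small_parameter[OF _ \<open>compact Q\<close>]) (simp_all add: char_det_zero)
  have "char_det k l H c (\<lambda>_. 0) \<noteq> 0" if "\<And>i. norm (c i) \<le> R" for c
    using R(3)[of R "\<lambda>i. c i / R"] that R(1) by (simp add: Q_def norm_divide)
  from spectral_radius_less[OF assms R(1) this] show ?thesis
    by (intro bdd_aboveI[of _ "1 / R\<^sup>2"]) (auto simp: less_imp_le)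
qed

text \<open>A zero on the torus of common radius \<sigma> > 0 makes 1/\<sigma>^2, which is at least
  1, an eigenvalue at a point of the unit torus, against \<open>gamma0 k l H < 1\<close>.\<close>

lemma char_det_nonzero_on_polydisc:
  assumes "l \<ge> 1" "gamma0 k l H < 1" "\<And>i. norm (c i) \<le> 1"
  shows "char_det k l H c (\<lambda>_. 0) \<noteq> 0"
proof (rule polydisc_nonzero[where G = "\<lambda>c. char_det k l H c (\<lambda>_. 0)" and p = "\<lambda>_. 1"])
  show "continuous_on UNIV (\<lambda>c. char_det k l H c (\<lambda>_. 0))"
    by (intro continuous_on_char_det continuous_intros) auto
  show "(\<lambda>z. char_det k l H (\<lambda>i. h i z) (\<lambda>_. 0)) holomorphic_on ball 0 1"
    if "\<And>i. h i holomorphic_on ball 0 1" for h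
    by (intro holomorphic_on_char_det) (simp_all add: that)
  fix \<sigma> :: real and d :: "nat + nat \<Rightarrow> complex"
  assume \<sigma>: "\<sigma> \<in> {0..1}" and d: "\<And>i. norm (d i) = 1"
  define W where "W = weighted_sum k l H (\<lambda>i j. d (Inl i) * d (Inr j))"
  have W: "W \<in> carrier_mat l l" by (auto simp: W_def weighted_sum_def)
  show "char_det k l H (\<lambda>i. complex_of_real (\<sigma> powr 1) * d i) (\<lambda>_. 0) \<noteq> 0"
  proof (cases "\<sigma> = 0")
    case True
    then show ?thesis using char_det_zero by simp
  next
    case False
    have "spectral_radius W \<le> gamma0 k l H"
      unfolding gamma0_torus W_def using d
      by (intro cSup_upper bdd_above_spectral_radius assms) auto
    moreover have "1 \<le> norm (1 / complex_of_real (\<sigma> ^ 2))"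
      using \<sigma> False by (simp add: norm_divide norm_power power_le_one)
    moreover have "norm e \<le> spectral_radius W" if "eigenvalue W e" for e
      using that spectral_radius_mem_max(2)[OF W] \<open>l \<ge> 1\<close> by (auto simp: spectrum_def)
    ultimately have "\<not> eigenvalue W (1 / complex_of_real (\<sigma> ^ 2))" using assms(2) by fastforce
    then show ?thesis using \<sigma> False
      by (subst char_det_eq_0_iff_eigenvalue[where d = d and \<mu> = "complex_of_real (\<sigma> ^ 2)"])
         (auto simp: W_def power2_eq_square)
  qed
qed (use assms in auto)

text \<open>Dilating the polydisc by 1 + s and admitting kernel values of size s form a single
  perturbation of the case s = 0, harmless for small s by compactness.\<close>

lemma char_det_nonzero_on_larger_polydisc:
  assumes "\<And>c. (\<And>i. norm (c i) \<le> 1) \<Longrightarrow> char_det k l H c (\<lambda>_. 0) \<noteq> 0"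
  obtains R \<eta> where "R > 1" "\<eta> > 0"
    "\<And>c \<kappa>. (\<And>i. norm (c i) \<le> R) \<Longrightarrow> (\<And>p. norm (\<kappa> p) \<le> \<eta>) \<Longrightarrow> char_det k l H c \<kappa> \<noteq> 0"
proof -
  define Q where "Q = {x :: nat + nat \<Rightarrow> complex. \<forall>i. x i \<in> cball 0 1}"
  define Q' where "Q' = {x :: nat \<times> nat \<Rightarrow> complex. \<forall>i. x i \<in> cball 0 1}"
  have comp: "compact (Q \<times> Q')"
    unfolding Q_def Q'_def by (intro compact_Times compact_functions_into) simp_all
  have "continuous_on ({0..1} \<times> (Q \<times> Q')) (\<lambda>(s::real, x).
      char_det k l H (\<lambda>i. of_real (1 + s) * fst x i) (\<lambda>p. of_real s * snd x p))"
    unfolding case_prod_beta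
    by (intro continuous_on_char_det continuous_intros)
       (rule continuous_on_product_then_coordinatewise, intro continuous_intros)+
  then obtain d where d: "d > 0" "d \<le> 1"
    "\<And>s x. s \<in> {0..d} \<Longrightarrow> x \<in> Q \<times> Q' \<Longrightarrow>
       char_det k l H (\<lambda>i. of_real (1 + s) * fst x i) (\<lambda>p. of_real s * snd x p) \<noteq> 0"
    by (rule nonzero_for_small_parameter[OF _ comp]) (use assms in \<open>auto simp: Q_def\<close>)
  show ?thesis
  proof (rule that[of "1 + d" d])
    fix c :: "nat + nat \<Rightarrow> complex" and \<kappa> :: "nat \<times> nat \<Rightarrow> complex"
    assume c: "\<And>i. norm (c i) \<le> 1 + d" "\<And>p. norm (\<kappa> p) \<le> d"
    define e where "e = complex_of_real (1 + d)"
    have e: "e \<noteq> 0" "norm e = 1 + d"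
      unfolding e_def norm_of_real of_real_eq_0_iff using d(1) by auto
    have "(\<lambda>i. c i / e, \<lambda>p. \<kappa> p / d) \<in> Q \<times> Q'"
      using c e d(1) by (simp add: Q_def Q'_def norm_divide)
    from d(3)[OF _ this, of d] d(1)
    have "char_det k l H (\<lambda>i. e * (c i / e)) (\<lambda>p. of_real d * (\<kappa> p / d)) \<noteq> 0"
      unfolding e_def by simp
    then show "char_det k l H c \<kappa> \<noteq> 0" using e(1) d(1) by simp
  qed (use d in auto)
qed

section \<open>Perturbation of the delays\<close>

text \<open>For large |z| the exponentials and kernel values lie in the enlarged zero-free polydisc.
  The remaining z form a compact set, on which absence of roots survives small changes of the
  delays.\<close>

lemma robustly_no_roots:
  fixes T :: "nat + nat \<Rightarrow> real" and K :: "nat \<times> nat \<Rightarrow> complex \<Rightarrow> complex"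
  assumes l: "l \<ge> 1" and \<gamma>: "gamma0 k l H < 1"
    and T: "\<And>i. T i \<le> B" "B \<ge> 0"
    and Kcont: "\<And>p. continuous_on UNIV (K p)"
    and Kdecay: "\<And>p z. Re z \<ge> - 1 \<Longrightarrow> norm z * norm (K p z) \<le> C"
    and \<delta>0: "\<delta>\<^sub>0 > 0" "\<And>z. Re z \<ge> - \<delta>\<^sub>0 \<Longrightarrow>
          char_det k l H (\<lambda>i. exp (- z * of_real (T i))) (\<lambda>p. K p z) \<noteq> 0"
  obtains \<epsilon> \<delta> where "\<epsilon> > 0" "\<delta> > 0"
    "\<And>T' z. (\<And>i. \<bar>T' i - T i\<bar> \<le> \<epsilon>) \<Longrightarrow> (\<And>i. T' i \<ge> 0) \<Longrightarrow> Re z \<ge> - \<delta> \<Longrightarrow>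
          char_det k l H (\<lambda>i. exp (- z * of_real (T' i))) (\<lambda>p. K p z) \<noteq> 0"
proof -
  obtain R \<eta> where R: "R > 1" "\<eta> > 0"
    "\<And>c \<kappa>. (\<And>i. norm (c i) \<le> R) \<Longrightarrow> (\<And>p. norm (\<kappa> p) \<le> \<eta>) \<Longrightarrow> char_det k l H c \<kappa> \<noteq> 0"
    using char_det_nonzero_on_larger_polydisc char_det_nonzero_on_polydisc[OF l \<gamma>] by metis
  \<comment> \<open>Beyond modulus M the decay bound C/|z| is at most \<eta>.\<close>
  define M where "M = max 1 (C / \<eta>)"
  \<comment> \<open>Perturbed delays will be at most B + 1, so on Re z \<ge> -\<delta> the
    exponentials have modulus at most e^(\<delta>(B+1)) \<le> R. The bounds by 1 and
    \<open>\<delta>\<^sub>0\<close> keep z where the decay and the absence of roots are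
    known.\<close>
  define \<delta> where "\<delta> = min (min \<delta>\<^sub>0 1) (ln R / (B + 1))"
  have \<delta>: "\<delta> > 0" "\<delta> \<le> \<delta>\<^sub>0" "\<delta> \<le> 1" "\<delta> * (B + 1) \<le> ln R"
  proof -
    have "\<delta> \<le> ln R / (B + 1)" by (simp add: \<delta>_def)
    then show "\<delta> * (B + 1) \<le> ln R" using T(2) by (simp add: pos_le_divide_eq)
  qed (use R(1) \<delta>0(1) T(2) in \<open>auto simp: \<delta>_def\<close>)
  define Z where "Z = {z :: complex. Re z \<ge> - \<delta>} \<inter> cball 0 M"
  have "compact Z" unfolding Z_def by (intro closed_Int_compact closed_halfspace_Re_ge compact_cball)
  \<comment> \<open>Delays are moved along directions in the cube \<open>I\<close> with an amplitude
    s, so that one scalar parameter covers all perturbations.\<close>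
  define I where "I = {d :: nat + nat \<Rightarrow> real. \<forall>i. d i \<in> {-1..1}}"
  have "compact I" unfolding I_def by (rule compact_functions_into) simp
  have Kc: "continuous_on S (\<lambda>x. K p (g x))" if "continuous_on S g" for S :: "(real \<times> complex \<times> (nat + nat \<Rightarrow> real)) set" and g p
    using that by (rule continuous_on_compose2[OF Kcont]) auto
  have dc: "continuous_on S (\<lambda>x. snd (snd x) i)" for S :: "(real \<times> complex \<times> (nat + nat \<Rightarrow> real)) set" and i
    by (rule continuous_on_product_then_coordinatewise) (intro continuous_intros)
  have "continuous_on ({0..1} \<times> (Z \<times> I)) (\<lambda>(s::real, x).
      char_det k l H (\<lambda>i. exp (- fst x * of_real (T i + s * snd x i))) (\<lambda>p. K p (fst x)))"
    unfolding case_prod_beta by (intro continuous_on_char_det continuous_intros Kc dc)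
  then obtain \<epsilon> where \<epsilon>: "\<epsilon> > 0" "\<epsilon> \<le> 1" "\<And>s x. s \<in> {0..\<epsilon>} \<Longrightarrow> x \<in> Z \<times> I \<Longrightarrow>
      char_det k l H (\<lambda>i. exp (- fst x * of_real (T i + s * snd x i))) (\<lambda>p. K p (fst x)) \<noteq> 0"
    by (rule nonzero_for_small_parameter[OF _ compact_Times[OF \<open>compact Z\<close> \<open>compact I\<close>]])
       (use \<delta>0(2) \<delta>(2) in \<open>auto simp: Z_def\<close>)
  show ?thesis
  proof (rule that[OF \<epsilon>(1) \<delta>(1)])
    fix T' :: "nat + nat \<Rightarrow> real" and z :: complex
    assume T': "\<And>i. \<bar>T' i - T i\<bar> \<le> \<epsilon>" "\<And>i. T' i \<ge> 0" and z: "Re z \<ge> - \<delta>"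
    show "char_det k l H (\<lambda>i. exp (- z * of_real (T' i))) (\<lambda>p. K p z) \<noteq> 0"
    proof (cases "norm z \<le> M")
      case True
      then show ?thesis
        using \<epsilon>(3)[of \<epsilon> "(z, \<lambda>i. (T' i - T i) / \<epsilon>)"] T'(1) \<epsilon>(1) z
        by (simp add: Z_def I_def abs_le_iff field_simps)
    next
      case False
      show ?thesis
      proof (rule R(3))
        fix i
        have "Re (- z * of_real (T' i)) \<le> \<delta> * T' i"
          using mult_right_mono[OF _ T'(2)[of i], of "- Re z" \<delta>] z by simp
        also have "\<dots> \<le> \<delta> * (B + 1)"
          using T(1)[of i] T'(1)[of i] \<epsilon>(2) \<delta>(1) by (intro mult_left_mono) auto
        finally have "Re (- z * of_real (T' i)) \<le> ln R" using \<delta>(4) by linarith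
        then show "norm (exp (- z * of_real (T' i))) \<le> R"
          using R(1) by (simp add: norm_exp_eq_Re ln_ge_iff)
      next
        fix p
        have z': "norm z > 0" "norm z \<ge> C / \<eta>" using False by (auto simp: M_def)
        have "norm z * norm (K p z) \<le> C" by (rule Kdecay) (use z \<delta>(3) in simp)
        also have "C \<le> norm z * \<eta>" using z'(2) R(2) by (simp add: field_simps)
        finally show "norm (K p z) \<le> \<eta>" using z'(1) by simp
      qed
    qed
  qed
qed

text \<open>
  A zero of the determinant on the torus of radii \<open>\<sigma> powr T i\<close> is the value at \<open>z = - ln \<sigma>\<close> of a
  limit of characteristic functions: at high frequency \<open>\<omega>\<close> an arbitrarily small change of the delays
  realises prescribed phases exactly, and the kernel becomes negligible. Hurwitz's theorem then yields a
  characteristic root.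
\<close>

lemma torus_zero_imp_root:
  fixes T :: "nat + nat \<Rightarrow> real" and K :: "nat \<times> nat \<Rightarrow> complex \<Rightarrow> complex"
  assumes T: "\<And>i. T i > 0" and Kholo: "\<And>p. K p holomorphic_on UNIV"
    and Kdecay: "\<And>p z. Re z \<ge> - \<delta> \<Longrightarrow> norm z * norm (K p z) \<le> C"
    and pos: "\<epsilon> > 0" "\<delta> > 0"
    and x: "\<And>i. norm (x i) = 1" and \<sigma>: "\<sigma> \<in> {0..1}"
    and zero: "char_det k l H (\<lambda>i. complex_of_real (\<sigma> powr T i) * x i) (\<lambda>_. 0) = 0"
  shows "\<exists>T' z. (\<forall>i. T i \<le> T' i \<and> T' i \<le> T i + \<epsilon>) \<and> Re z > - \<delta> \<and>
           char_det k l H (\<lambda>i. exp (- z * of_real (T' i))) (\<lambda>p. K p z) = 0"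
proof (rule ccontr)
  assume no_root: "\<not> ?thesis"
  \<comment> \<open>The limit function: the phases are frozen at \<open>x\<close> and the kernel is
    dropped.\<close>
  define F where "F z = char_det k l H (\<lambda>i. x i * exp (- z * of_real (T i))) (\<lambda>_. 0)" for z
  \<comment> \<open>The frequency whose full period 2 pi/\<omega> equals \<epsilon>/(n + 1).\<close>
  define \<omega> where "\<omega> n = real (Suc n) * (2 * pi / \<epsilon>)" for n
  have \<omega>: "\<omega> n > 0" for n using pos by (simp add: \<omega>_def)
  \<comment> \<open>\<open>y n i\<close> is the excess, in full turns, of the phase
    \<open>- \<omega> n * T i\<close> over the target \<open>Arg2pi (x i)\<close>. Lengthening the
    delay by the fractional part of a period removes it modulo 2 pi.\<close>
  define y where "y n i = (- Arg2pi (x i) - \<omega> n * T i) / (2 * pi)" for n i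
  define T' where "T' n i = T i + 2 * pi * frac (y n i) / \<omega> n" for n i
  have T': "0 \<le> T' n i - T i" "T' n i - T i \<le> \<epsilon> / Suc n" for n i
  proof -
    show "0 \<le> T' n i - T i" using \<omega>[of n] by (simp add: T'_def)
    have "2 * pi * frac (y n i) / \<omega> n \<le> 2 * pi * 1 / \<omega> n"
      using \<omega>[of n] by (intro divide_right_mono mult_left_mono) (auto simp: less_imp_le[OF frac_lt_1])
    also have "\<dots> = \<epsilon> / Suc n" using pos by (simp add: \<omega>_def)
    finally show "T' n i - T i \<le> \<epsilon> / Suc n" by (simp add: T'_def)
  qed
  have phase: "exp (- (\<i> * of_real (\<omega> n)) * of_real (T' n i)) = x i" for n i
  proof -
    have "\<omega> n * T' n i = \<omega> n * T i + 2 * pi * (y n i - of_int \<lfloor>y n i\<rfloor>)"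
      using \<omega>[of n] by (simp add: T'_def frac_def field_simps)
    also have "\<dots> = - Arg2pi (x i) - 2 * pi * of_int \<lfloor>y n i\<rfloor>"
      by (simp add: y_def field_simps)
    finally have "- (\<omega> n * T' n i) = Arg2pi (x i) + 2 * of_int \<lfloor>y n i\<rfloor> * pi" by simp
    then have "- (\<i> * of_real (\<omega> n)) * of_real (T' n i)
        = \<i> * of_real (Arg2pi (x i)) + 2 * of_int \<lfloor>y n i\<rfloor> * of_real pi * \<i>"
      by (metis (no_types, opaque_lifting) mult.assoc mult.commute distrib_left mult_minus_left mult_minus_right
            of_real_add of_real_minus of_real_mult of_real_numeral of_real_of_int_eq)
    also have "exp \<dots> = exp (\<i> * of_real (Arg2pi (x i)))"
      using exp_integer_2pi[of "of_int \<lfloor>y n i\<rfloor>"] by (simp add: exp_add)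
    also have "\<dots> = x i" using Arg2pi_eq[of "x i"] x[of i] by simp
    finally show ?thesis .
  qed
  \<comment> \<open>The characteristic determinant with delays \<open>T' n\<close>, recentred at
    i\<omega>; the exact phases turn its exponentials into \<open>x i\<close> times those at
    z.\<close>
  define f where "f n z = char_det k l H (\<lambda>i. x i * exp (- z * of_real (T' n i)))
      (\<lambda>p. K p (\<i> * of_real (\<omega> n) + z))" for n z
  define S where "S = {z :: complex. Re z > - \<delta>}"
  have f_nz: "f n z \<noteq> 0" if "z \<in> S" for n z
  proof -
    have "exp (- (\<i> * of_real (\<omega> n) + z) * of_real (T' n i)) = x i * exp (- z * of_real (T' n i))" for i
      by (subst phase[of n i, symmetric], subst exp_add[symmetric]) (simp add: algebra_simps)
    then have "f n z = char_det k l H (\<lambda>i. exp (- (\<i> * of_real (\<omega> n) + z) * of_real (T' n i)))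
        (\<lambda>p. K p (\<i> * of_real (\<omega> n) + z))" by (simp add: f_def)
    moreover have "T i \<le> T' n i \<and> T' n i \<le> T i + \<epsilon>" for i
    proof -
      have "\<epsilon> / Suc n \<le> \<epsilon>" using pos by (simp add: divide_le_eq)
      then show ?thesis using T'[where n = n and i = i] by linarith
    qed
    moreover have "Re (\<i> * of_real (\<omega> n) + z) > - \<delta>" using that by (simp add: S_def)
    ultimately show ?thesis using no_root by metis
  qed
  have "\<sigma> \<noteq> 0" using zero char_det_zero by (cases "\<sigma> = 0") auto
  have F0: "F (of_real (- ln \<sigma>)) = 0"
  proof -
    have "exp (- complex_of_real (- ln \<sigma>) * of_real (T i)) = of_real (\<sigma> powr T i)" for i
      using \<sigma> \<open>\<sigma> \<noteq> 0\<close> by (simp add: powr_def mult.commute flip: exp_of_real of_real_mult)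
    then show ?thesis using zero by (simp add: F_def mult.commute)
  qed
  have "F (of_real (- ln \<sigma>)) \<noteq> 0"
  proof (rule Hurwitz_no_zeros[where S = S and \<F> = f and g = F and ?z0.0 = "of_real (- ln \<sigma>)"])
    show "open S" "connected S"
      unfolding S_def by (auto intro: open_halfspace_Re_gt convex_connected convex_halfspace_Re_gt)
    show "f n holomorphic_on S" for n
    proof -
      have "(\<lambda>z. \<i> * of_real (\<omega> n) + z) holomorphic_on S" by (intro holomorphic_intros)
      from holomorphic_on_compose_gen[OF this Kholo]
      have "(\<lambda>z. K p (\<i> * of_real (\<omega> n) + z)) holomorphic_on S" for p by (simp add: o_def)
      then show ?thesis unfolding f_def by (intro holomorphic_on_char_det) (auto intro!: holomorphic_intros)
    qed
    show "F holomorphic_on S" unfolding F_def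
      by (intro holomorphic_on_char_det) (auto intro!: holomorphic_intros)
    have "0 < \<sigma>" using \<sigma> \<open>\<sigma> \<noteq> 0\<close> by simp
    then have "ln \<sigma> \<le> 0" using \<sigma> by simp
    then show "of_real (- ln \<sigma>) \<in> S" using pos by (simp add: S_def)
    show "f n z \<noteq> 0" if "z \<in> S" for n z using that by (rule f_nz)
    \<comment> \<open>Along the positive real axis every exponential tends to 0, as the delays are
      positive, so F tends to its nonzero value at the centre.\<close>
    show "\<not> F constant_on S"
    proof
      assume "F constant_on S"
      then have F: "F z = 0" if "z \<in> S" for z
        using F0 that \<open>of_real (- ln \<sigma>) \<in> S\<close> unfolding constant_on_def by metis
      have "((\<lambda>t. x i * exp (- complex_of_real t * of_real (T i))) \<longlongrightarrow> 0) at_top" for i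
      proof (rule tendsto_norm_zero_cancel)
        have "((\<lambda>t. exp (- (T i * t))) \<longlongrightarrow> 0) at_top"
          using T[of i] by real_asymp
        then show "((\<lambda>t. norm (x i * exp (- complex_of_real t * of_real (T i)))) \<longlongrightarrow> 0) at_top"
          by (simp add: norm_mult x norm_exp_eq_Re mult.commute)
      qed
      then have "((\<lambda>t. F (of_real t)) \<longlongrightarrow> char_det k l H (\<lambda>_. 0) (\<lambda>_. 0)) at_top"
        unfolding F_def by (rule tendsto_char_det)
      moreover have "((\<lambda>t. F (of_real t)) \<longlongrightarrow> 0) at_top"
      proof (rule tendsto_eventually)
        show "\<forall>\<^sub>F t in at_top. F (complex_of_real t) = 0"
          using eventually_ge_at_top[of 0] by eventually_elim (rule F, use pos in \<open>simp add: S_def\<close>)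
      qed
      ultimately show False
        using char_det_zero[of k l H] tendsto_unique[OF trivial_limit_at_top_linorder] by blast
    qed
    show "uniform_limit Y f F sequentially" if "compact Y" "Y \<subseteq> S" for Y
    proof (rule uniform_limitI)
      fix e :: real assume "e > 0"
      \<comment> \<open>Delay changes and kernel values are both written as s times bounded data: s
        = 0 gives \<open>F z\<close>, and a small s gives \<open>f n z\<close>. Continuity uniform
        over the compact set of data then yields uniform convergence.\<close>
      define I where "I = {d :: nat + nat \<Rightarrow> real. \<forall>i. d i \<in> {0..1}}"
      define Q where "Q = {\<kappa> :: nat \<times> nat \<Rightarrow> complex. \<forall>p. \<kappa> p \<in> cball 0 1}"
      have comp: "compact (Y \<times> I \<times> Q)"
        unfolding I_def Q_def by (intro compact_Times compact_functions_into that) simp_all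
      have "continuous_on ({0..1} \<times> (Y \<times> I \<times> Q)) (\<lambda>(s::real, u).
          char_det k l H (\<lambda>i. x i * exp (- fst u * of_real (T i + s * fst (snd u) i)))
            (\<lambda>p. of_real s * snd (snd u) p))"
        unfolding case_prod_beta
        by (intro continuous_on_char_det continuous_intros;
            rule continuous_on_product_then_coordinatewise; intro continuous_intros)
      from uniform_in_parameter[OF this comp \<open>e > 0\<close>]
      obtain s\<^sub>0 where s\<^sub>0: "s\<^sub>0 > 0" "\<And>s t u. s \<in> {0..1} \<Longrightarrow> t \<in> {0..1} \<Longrightarrow> u \<in> Y \<times> I \<times> Q \<Longrightarrow> \<bar>s - t\<bar> < s\<^sub>0 \<Longrightarrow>
          dist (char_det k l H (\<lambda>i. x i * exp (- fst u * of_real (T i + s * fst (snd u) i)))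
                  (\<lambda>p. of_real s * snd (snd u) p))
               (char_det k l H (\<lambda>i. x i * exp (- fst u * of_real (T i + t * fst (snd u) i)))
                  (\<lambda>p. of_real t * snd (snd u) p)) < e" by blast
      \<comment> \<open>The amplitude is fixed first. Then n is taken so large that the delay
        changes are at most s and |i\<omega> + z| is at least 1 + |C|/s, which brings the kernel
        values down to s.\<close>
      define s where "s = min 1 (s\<^sub>0 / 2)"
      have s: "s > 0" "s \<le> 1" "s < s\<^sub>0" using s\<^sub>0(1) by (auto simp: s_def)
      obtain B where B: "\<And>z. z \<in> Y \<Longrightarrow> norm z \<le> B"
        using compact_imp_bounded[OF \<open>compact Y\<close>] unfolding bounded_iff by blast
      have "\<forall>\<^sub>F n in sequentially. \<epsilon> / Suc n \<le> s \<and> \<omega> n \<ge> B + 1 + \<bar>C\<bar> / s"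
      proof (rule eventually_conj)
        have "(\<lambda>n. \<epsilon> / Suc n) \<longlonglongrightarrow> 0" by real_asymp
        from order_tendstoD(2)[OF this s(1)] show "\<forall>\<^sub>F n in sequentially. \<epsilon> / Suc n \<le> s"
          by (rule eventually_mono) simp
        have "filterlim (\<lambda>n. real (Suc n) * (2 * pi / \<epsilon>)) at_top sequentially"
          using pos by real_asymp
        then show "\<forall>\<^sub>F n in sequentially. \<omega> n \<ge> B + 1 + \<bar>C\<bar> / s"
          unfolding \<omega>_def filterlim_at_top by (rule spec)
      qed
      then show "\<forall>\<^sub>F n in sequentially. \<forall>z\<in>Y. dist (f n z) (F z) < e"
      proof (eventually_elim, intro ballI)
        fix n z assume n: "\<epsilon> / Suc n \<le> s \<and> \<omega> n \<ge> B + 1 + \<bar>C\<bar> / s" and z: "z \<in> Y"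
        define w where "w = \<i> * of_real (\<omega> n) + z"
        have "\<omega> n \<le> norm w + norm z"
          using norm_triangle_ineq4[of w z] \<omega>[of n] by (simp add: w_def norm_mult)
        then have w: "norm w \<ge> 1 + \<bar>C\<bar> / s" using n B[OF z] by linarith
        moreover have "0 \<le> \<bar>C\<bar> / s" using s(1) by simp
        ultimately have "norm w > 0" by linarith
        have "norm (K p w) \<le> s" for p
        proof -
          have "norm w * norm (K p w) \<le> C"
            using z \<open>Y \<subseteq> S\<close> by (intro Kdecay) (auto simp: w_def S_def less_imp_le)
          also have "C \<le> norm w * s" using w s(1) by (simp add: field_simps)
          finally show ?thesis using \<open>norm w > 0\<close> by simp
        qed
        then have "(\<lambda>p. K p w / s) \<in> Q" using s(1) by (simp add: Q_def norm_divide)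
        moreover have "(\<lambda>i. (T' n i - T i) / s) \<in> I"
        proof -
          have "T' n i - T i \<le> s" for i using T'(2)[of n i] n by linarith
          then show ?thesis using T'(1)[of n] s(1) by (simp add: I_def divide_le_eq)
        qed
        ultimately have "dist (char_det k l H (\<lambda>i. x i * exp (- z * of_real (T i + s * ((T' n i - T i) / s))))
                  (\<lambda>p. of_real s * (K p w / s)))
               (char_det k l H (\<lambda>i. x i * exp (- z * of_real (T i + 0 * ((T' n i - T i) / s))))
                  (\<lambda>p. of_real 0 * (K p w / s))) < e"
          using s\<^sub>0(2)[of s 0 "(z, \<lambda>i. (T' n i - T i) / s, \<lambda>p. K p w / s)"] z s by simp
        then show "dist (f n z) (F z) < e"
          using s(1) by (simp add: f_def F_def w_def)
      qed
    qed
  qed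
  then show False using F0 by simp
qed

text \<open>The radii \<sigma>^(T i) are the moduli of the exponentials at z = -ln \<sigma>, so the
  continuation uses the exponents \<open>T\<close>: a zero on such a torus would give a root for
  slightly longer delays. The room beyond the unit polydisc then makes the inequality strict,
  through the bound 1/R^2.\<close>

lemma gamma0_less_one:
  fixes T :: "nat + nat \<Rightarrow> real" and K :: "nat \<times> nat \<Rightarrow> complex \<Rightarrow> complex"
  assumes l: "l \<ge> 1" and T: "\<And>i. T i > 0" and Kholo: "\<And>p. K p holomorphic_on UNIV"
    and Kdecay: "\<And>p z. Re z \<ge> - \<delta> \<Longrightarrow> norm z * norm (K p z) \<le> C"
    and pos: "\<epsilon> > 0" "\<delta> > 0"
    and no_root: "\<And>T' z. (\<And>i. T i \<le> T' i) \<Longrightarrow> (\<And>i. T' i \<le> T i + \<epsilon>) \<Longrightarrow> Re z > - \<delta> \<Longrightarrow>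
           char_det k l H (\<lambda>i. exp (- z * of_real (T' i))) (\<lambda>p. K p z) \<noteq> 0"
  shows "gamma0 k l H < 1"
proof -
  have "char_det k l H c (\<lambda>_. 0) \<noteq> 0" if "\<And>i. norm (c i) \<le> 1" for c
  proof (rule polydisc_nonzero[where G = "\<lambda>c. char_det k l H c (\<lambda>_. 0)" and p = T])
    show "continuous_on UNIV (\<lambda>c. char_det k l H c (\<lambda>_. 0))"
      by (intro continuous_on_char_det continuous_intros) auto
    show "(\<lambda>z. char_det k l H (\<lambda>i. h i z) (\<lambda>_. 0)) holomorphic_on ball 0 1"
      if "\<And>i. h i holomorphic_on ball 0 1" for h
      by (intro holomorphic_on_char_det) (simp_all add: that)
    show "char_det k l H (\<lambda>i. complex_of_real (\<sigma> powr T i) * x i) (\<lambda>_. 0) \<noteq> 0"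
      if "\<sigma> \<in> {0..1}" "\<And>i. norm (x i) = 1" for \<sigma> x
      using torus_zero_imp_root[where T = T and K = K and x = x and \<sigma> = \<sigma> and k = k and l = l and H = H,
          OF T Kholo Kdecay pos that(2,1)] no_root by blast
  qed (use T that in auto)
  then obtain R where R: "R > 1" "\<And>c. (\<And>i. norm (c i) \<le> R) \<Longrightarrow> char_det k l H c (\<lambda>_. 0) \<noteq> 0"
    using char_det_nonzero_on_larger_polydisc[of k l H] by (metis less_imp_le norm_zero)
  have "R > 0" using R(1) by simp
  have "gamma0 k l H \<le> 1 / R\<^sup>2"
    unfolding gamma0_torus
  proof (rule cSup_least)
    show "{spectral_radius (weighted_sum k l H (\<lambda>i j. d (Inl i) * d (Inr j))) | d. \<forall>i. norm (d i) = 1} \<noteq> {}"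
      by (auto intro: exI[of _ "\<lambda>_. 1"])
  qed (use spectral_radius_less[OF l \<open>R > 0\<close> R(2)] in \<open>auto simp: less_imp_le\<close>)
  also have "\<dots> < 1" using R(1) by (simp add: power2_eq_square less_1_mult)
  finally show ?thesis .
qed

section \<open>Return to the integral-difference equation\<close>

lemma det_char_matrix_IDE:
  assumes "\<And>i. i \<in> {1..k} \<Longrightarrow> T (Inl i) = r i" "\<And>j. j \<in> {1..l} \<Longrightarrow> T (Inr j) = s j"
    and "\<And>a b. a < l \<Longrightarrow> b < l \<Longrightarrow> K (a, b) z =
           integral {-\<tau>..0} (\<lambda>t. complex_of_real (w1 t $$ (a, b)) * exp (z * complex_of_real t))"
  shows "det (char_matrix_IDE k l H w1 \<tau> r s z) = char_det k l H (\<lambda>i. exp (- z * of_real (T i))) (\<lambda>p. K p z)"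
proof -
  have "det (char_matrix_IDE k l H w1 \<tau> r s z)
      = char_det k l H (\<lambda>i. exp (- z * of_real (T i))) (\<lambda>p. kernel_transform l w1 \<tau> z $$ p)"
    unfolding char_matrix_IDE_def
    by (rule det_weighted_sum) (auto simp: kernel_transform_def assms exp_add[symmetric] algebra_simps)
  also have "\<dots> = char_det k l H (\<lambda>i. exp (- z * of_real (T i))) (\<lambda>p. K p z)"
    by (rule char_det_cong) (auto simp: kernel_transform_def assms)
  finally show ?thesis .
qed

text \<open>Only the finitely many entries of the l by l block can be nonzero, so the sum of the
  absolute values of their constants serves all of them.\<close>

lemma common_decay_bound:
  fixes K :: "nat \<times> nat \<Rightarrow> complex \<Rightarrow> complex"
  assumes "\<And>p. \<exists>C. \<forall>z. Re z \<ge> - \<beta> \<longrightarrow> norm z * norm (K p z) \<le> C"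
    and "\<And>a b z. \<not> (a < l \<and> b < l) \<Longrightarrow> K (a, b) z = 0"
  obtains C where "\<And>p z. Re z \<ge> - \<beta> \<Longrightarrow> norm z * norm (K p z) \<le> C"
proof -
  obtain C where C: "\<And>p z. Re z \<ge> - \<beta> \<Longrightarrow> norm z * norm (K p z) \<le> C p" using assms(1) by metis
  define P where "P = {..<l} \<times> {..<l}"
  have "norm z * norm (K p z) \<le> (\<Sum>p\<in>P. \<bar>C p\<bar>)" if z: "Re z \<ge> - \<beta>" for p z
  proof (cases "p \<in> P")
    case True
    have "norm z * norm (K p z) \<le> \<bar>C p\<bar>" using C[OF z, of p] by linarith
    also have "\<dots> \<le> (\<Sum>p\<in>P. \<bar>C p\<bar>)" using True by (intro member_le_sum) (auto simp: P_def)
    finally show ?thesis .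
  next
    case False
    then have "K p z = 0" using assms(2)[of "fst p" "snd p"] by (auto simp: P_def mem_Times_iff)
    then show ?thesis by (simp add: sum_nonneg)
  qed
  then show ?thesis using that by blast
qed

theorem proposition2:
  fixes k l :: nat
    and H :: "nat \<Rightarrow> nat \<Rightarrow> real mat"
    and w1 :: "real \<Rightarrow> real mat"
    and r s :: "nat \<Rightarrow> real"
    and \<tau> :: real
  assumes "k \<ge> 1" and "l \<ge> 1"
    and "\<And>i j. i \<in> {1..k} \<Longrightarrow> j \<in> {1..l} \<Longrightarrow> H i j \<in> carrier_mat l l"
    and "\<And>t. t \<in> {-\<tau>..0} \<Longrightarrow> w1 t \<in> carrier_mat l l"
    and "\<And>a b. a < l \<Longrightarrow> b < l \<Longrightarrow> piecewise_C1_on (\<lambda>t. w1 t $$ (a, b)) (-\<tau>) 0"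
    and "\<And>i i'. 1 \<le> i \<Longrightarrow> i < i' \<Longrightarrow> i' \<le> k \<Longrightarrow> r i > r i'" and "r k > 0"
    and "\<And>j j'. 1 \<le> j \<Longrightarrow> j < j' \<Longrightarrow> j' \<le> l \<Longrightarrow> s j > s j'" and "s l > 0"
    and "\<tau> = r 1 + s 1"
  shows "strongly_stable k l H w1 \<tau> r s \<longleftrightarrow>
           c0 k l H w1 \<tau> r s < 0 \<and> gamma0 k l H < 1"
proof -
  \<comment> \<open>Indices outside the ranges receive the delay 1, so that \<open>T\<close> is
    positive and bounded on the whole index type.\<close>
  define T where "T = case_sum (\<lambda>i. if i \<in> {1..k} then r i else 1) (\<lambda>j. if j \<in> {1..l} then s j else 1)"
  define K where "K p = (\<lambda>z. if fst p < l \<and> snd p < l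
      then integral {-\<tau>..0} (\<lambda>t. complex_of_real (w1 t $$ p) * exp (z * complex_of_real t)) else 0)" for p
  have r: "r i > 0 \<and> r i \<le> r 1" if "i \<in> {1..k}" for i
    using that assms(6)[of i k] assms(6)[of 1 i] \<open>r k > 0\<close> by (cases "i = k"; cases "i = 1") auto
  have s: "s j > 0 \<and> s j \<le> s 1" if "j \<in> {1..l}" for j
    using that assms(8)[of j l] assms(8)[of 1 j] \<open>s l > 0\<close> by (cases "j = l"; cases "j = 1") auto
  have T_pos: "T i > 0" for i using r s by (auto simp: T_def split: sum.split)
  have T_le: "T i \<le> 1 + r 1 + s 1" for i
  proof -
    have "r 1 > 0" "s 1 > 0" using r[of 1] s[of 1] \<open>k \<ge> 1\<close> \<open>l \<ge> 1\<close> by auto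
    then show ?thesis using r s by (cases i) (auto simp: T_def add_increasing add_increasing2)
  qed
  have Kholo: "K p holomorphic_on UNIV" for p
    using piecewise_C1_exp_integral(1)[OF assms(5), of "fst p" "snd p"]
    by (cases "fst p < l \<and> snd p < l") (auto simp: K_def)
  have Kdecay: "\<exists>C. \<forall>z. Re z \<ge> - \<beta> \<longrightarrow> norm z * norm (K p z) \<le> C" for p \<beta>
    using piecewise_C1_exp_integral(2)[OF assms(5), of "fst p" "snd p" \<beta>]
    by (cases "fst p < l \<and> snd p < l") (auto simp: K_def)
  have Kzero: "K (a, b) z = 0" if "\<not> (a < l \<and> b < l)" for a b z using that by (auto simp: K_def)
  have det_eq: "det (char_matrix_IDE k l H w1 \<tau> (\<lambda>i. r i + dr i) (\<lambda>j. s j + ds j) z)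
      = char_det k l H (\<lambda>i. exp (- z * of_real (T' i))) (\<lambda>p. K p z)"
    if "\<And>i. i \<in> {1..k} \<Longrightarrow> T' (Inl i) = r i + dr i" "\<And>j. j \<in> {1..l} \<Longrightarrow> T' (Inr j) = s j + ds j" for dr ds T' z
    by (rule det_char_matrix_IDE) (auto simp: that K_def)
  have root_le: "ereal (Re z) \<le> c0 k l H w1 \<tau> r' s'" if "det (char_matrix_IDE k l H w1 \<tau> r' s' z) = 0" for r' s' z
    unfolding c0_def using that by (intro Sup_upper) auto
  show ?thesis
  proof (intro iffI conjI)
    assume "strongly_stable k l H w1 \<tau> r s"
    then obtain \<epsilon>1 \<epsilon>2 where \<epsilon>: "\<epsilon>1 > 0" "\<epsilon>2 > 0" and
      stable: "\<And>dr ds. L2_set dr {1..k} < \<epsilon>1 \<Longrightarrow> L2_set ds {1..l} < \<epsilon>1 \<Longrightarrow>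
           (\<forall>i\<in>{1..k}. r i + dr i \<ge> 0) \<Longrightarrow> (\<forall>j\<in>{1..l}. s j + ds j \<ge> 0) \<Longrightarrow>
           c0 k l H w1 \<tau> (\<lambda>i. r i + dr i) (\<lambda>j. s j + ds j) < ereal (- \<epsilon>2)"
      unfolding strongly_stable_def by blast
    have "c0 k l H w1 \<tau> r s < ereal (- \<epsilon>2)"
      using stable[of "\<lambda>_. 0" "\<lambda>_. 0"] \<epsilon>(1) r s by (auto simp: L2_set_def less_imp_le)
    also have "\<dots> < 0" using \<epsilon>(2) by simp
    finally show "c0 k l H w1 \<tau> r s < 0" .
    \<comment> \<open>The L2 norm is at most the sum of at most k + l absolute values, so changes
      bounded by this \<epsilon> in each coordinate stay below \<open>\<epsilon>1\<close>.\<close>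
    define \<epsilon> where "\<epsilon> = \<epsilon>1 / (2 * (real k + real l + 1))"
    have "\<epsilon> > 0" using \<epsilon>(1) by (simp add: \<epsilon>_def)
    have L2_less: "L2_set d {1..n} < \<epsilon>1" if "n \<le> k + l" "\<And>i. i \<in> {1..n} \<Longrightarrow> \<bar>d i\<bar> \<le> \<epsilon>" for d n
    proof -
      have "L2_set d {1..n} \<le> (\<Sum>i=1..n. \<bar>d i\<bar>)" by (rule L2_set_le_sum_abs)
      also have "\<dots> \<le> real n * \<epsilon>" using sum_bounded_above[of "{1..n}" "\<lambda>i. \<bar>d i\<bar>" \<epsilon>] that by simp
      also have "\<dots> \<le> (real k + real l + 1) * \<epsilon>" using that(1) \<open>\<epsilon> > 0\<close> by (intro mult_right_mono) auto
      also have "\<dots> < \<epsilon>1" using \<epsilon>(1) by (simp add: \<epsilon>_def divide_less_eq)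
      finally show ?thesis .
    qed
    obtain C where C: "\<And>p z. Re z \<ge> - \<epsilon>2 \<Longrightarrow> norm z * norm (K p z) \<le> C"
      using common_decay_bound[where K = K, OF Kdecay Kzero] by blast
    show "gamma0 k l H < 1"
    proof (rule gamma0_less_one[OF \<open>l \<ge> 1\<close> T_pos Kholo C \<open>\<epsilon> > 0\<close> \<open>\<epsilon>2 > 0\<close>])
      fix T' z
      assume T': "\<And>i. T i \<le> T' i" "\<And>i. T' i \<le> T i + \<epsilon>" and z: "Re z > - \<epsilon>2"
      define dr where "dr i = T' (Inl i) - T (Inl i)" for i
      define ds where "ds j = T' (Inr j) - T (Inr j)" for j
      have d: "0 \<le> dr i" "\<bar>dr i\<bar> \<le> \<epsilon>" "0 \<le> ds i" "\<bar>ds i\<bar> \<le> \<epsilon>" for i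
        using T'[of "Inl i"] T'[of "Inr i"] by (auto simp: dr_def ds_def)
      have "c0 k l H w1 \<tau> (\<lambda>i. r i + dr i) (\<lambda>j. s j + ds j) < ereal (- \<epsilon>2)"
        using r s d by (intro stable L2_less) (auto intro!: add_nonneg_nonneg simp: less_imp_le)
      moreover have "ereal (- \<epsilon>2) < ereal (Re z)" using z by simp
      ultimately have "det (char_matrix_IDE k l H w1 \<tau> (\<lambda>i. r i + dr i) (\<lambda>j. s j + ds j) z) \<noteq> 0"
        using root_le by (metis less_le_trans not_less_iff_gr_or_eq)
      then show "char_det k l H (\<lambda>i. exp (- z * of_real (T' i))) (\<lambda>p. K p z) \<noteq> 0"
        by (subst (asm) det_eq[of T']) (auto simp: dr_def ds_def T_def)
    qed
  next
    assume "c0 k l H w1 \<tau> r s < 0 \<and> gamma0 k l H < 1"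
    then have c0: "c0 k l H w1 \<tau> r s < ereal 0" and \<gamma>: "gamma0 k l H < 1" by (auto simp: zero_ereal_def)
    \<comment> \<open>The gap below 0 leaves a half plane Re z \<ge> c, with c < 0, without
      characteristic roots of the unperturbed equation.\<close>
    from c0 obtain c where c: "c0 k l H w1 \<tau> r s < ereal c" "c < 0"
      using ereal_dense2[OF c0] by auto
    obtain C where C: "\<And>p z. Re z \<ge> - 1 \<Longrightarrow> norm z * norm (K p z) \<le> C"
      using common_decay_bound[where K = K, OF Kdecay Kzero] by blast
    have unperturbed: "char_det k l H (\<lambda>i. exp (- z * of_real (T i))) (\<lambda>p. K p z) \<noteq> 0" if "Re z \<ge> - (- c)" for z
    proof -
      have "c0 k l H w1 \<tau> r s < ereal (Re z)" using c(1) that by (simp add: less_le_trans)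
      then have "det (char_matrix_IDE k l H w1 \<tau> r s z) \<noteq> 0" using root_le[of r s z] by auto
      then show ?thesis
        using det_eq[of T "\<lambda>_. 0" "\<lambda>_. 0" z] by (simp add: T_def)
    qed
    have "- c > 0" "1 + r 1 + s 1 \<ge> 0"
      using c(2) r[of 1] s[of 1] \<open>k \<ge> 1\<close> \<open>l \<ge> 1\<close> by auto
    then obtain \<epsilon> \<delta> where \<epsilon>: "\<epsilon> > 0" "\<delta> > 0" and
      no_root: "\<And>T' z. (\<And>i. \<bar>T' i - T i\<bar> \<le> \<epsilon>) \<Longrightarrow> (\<And>i. T' i \<ge> 0) \<Longrightarrow> Re z \<ge> - \<delta> \<Longrightarrow>
          char_det k l H (\<lambda>i. exp (- z * of_real (T' i))) (\<lambda>p. K p z) \<noteq> 0"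
      using robustly_no_roots[OF \<open>l \<ge> 1\<close> \<gamma> T_le _ holomorphic_on_imp_continuous_on[OF Kholo] C _ unperturbed] by blast
    show "strongly_stable k l H w1 \<tau> r s"
      unfolding strongly_stable_def
    \<comment> \<open>Half of \<delta>: absence of roots with Re z \<ge> -\<delta> bounds the
      supremum by -\<delta> only weakly, while strong stability asks for a strict
      inequality.\<close>
    proof (rule exI[of _ \<epsilon>], rule exI[of _ "\<delta> / 2"], intro conjI allI impI)
      fix dr ds :: "nat \<Rightarrow> real"
      assume d: "L2_set dr {1..k} < \<epsilon> \<and> L2_set ds {1..l} < \<epsilon> \<and>
           (\<forall>i\<in>{1..k}. r i + dr i \<ge> 0) \<and> (\<forall>j\<in>{1..l}. s j + ds j \<ge> 0)"
      \<comment> \<open>Only indices within the ranges are perturbed; the padding value 1 stays, so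
        closeness and nonnegativity hold at every index.\<close>
      define T' where "T' i = T i + case_sum (\<lambda>i. if i \<in> {1..k} then dr i else 0)
          (\<lambda>j. if j \<in> {1..l} then ds j else 0) i" for i
      have small: "\<bar>f i\<bar> \<le> \<epsilon>" if "L2_set f {1..n} < \<epsilon>" "i \<in> {1..n}" for f :: "nat \<Rightarrow> real" and n i
      proof -
        have "\<bar>f i\<bar> = L2_set (\<lambda>i. \<bar>f i\<bar>) {i}" by (simp add: L2_set_def)
        also have "\<dots> \<le> L2_set f {1..n}"
          using that(2) member_le_L2_set[of "{1..n}" i "\<lambda>i. \<bar>f i\<bar>"] by (simp add: L2_set_def)
        finally show ?thesis using that(1) by simp
      qed
      have "\<bar>T' i - T i\<bar> \<le> \<epsilon>" for i
        using small d \<epsilon>(1) by (cases i) (auto simp: T'_def)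
      moreover have "T' i \<ge> 0" for i
        using d by (cases i) (auto simp: T'_def T_def)
      ultimately have "det (char_matrix_IDE k l H w1 \<tau> (\<lambda>i. r i + dr i) (\<lambda>j. s j + ds j) z) \<noteq> 0"
        if "Re z \<ge> - \<delta>" for z
        using no_root[of T' z] that by (subst det_eq[of T']) (auto simp: T'_def T_def)
      then have "c0 k l H w1 \<tau> (\<lambda>i. r i + dr i) (\<lambda>j. s j + ds j) \<le> ereal (- \<delta>)"
        unfolding c0_def by (intro Sup_least) (force simp: not_le)
      also have "\<dots> < ereal (- (\<delta> / 2))" using \<epsilon>(2) by simp
      finally show "c0 k l H w1 \<tau> (\<lambda>i. r i + dr i) (\<lambda>j. s j + ds j) < ereal (- (\<delta> / 2))" .
    qed (use \<epsilon> in auto)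
  qed
qed

end
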